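(* Assume that $\mathbb{C}(\mathcal{H}_+)\subset\mathcal{H}_+$. If $\mathcal{L}$ is a square-integrable $\mathcal{H}$-valued Lévy process with non-decreasing paths and $\mathcal{Y}_0$ is non-negative definite, then the mild solution $\mathcal{Y}$ of $d\mathcal{Y}(t)=\mathbb{C}\mathcal{Y}(t)\,dt+d\mathcal{L}(t)$, $\mathcal{Y}(0)=\mathcal{Y}_0$, is non-negative definite, i.e. for every $t\ge 0$ the operator $\mathcal{Y}(t)$ is almost surely non-negative definite.
   Context: $H$ is a real separable Hilbert space with inner product $(\cdot,\cdot)_H$, and $\mathcal{H}=L_{\mathrm{HS}}(H)$ is the separable Hilbert space of Hilbert-Schmidt operators on $H$. $\mathcal{H}_+$ denotes the convex cone of non-negative definite operators in $\mathcal{H}$, where $\mathcal{T}$ is non-negative definite if $(\mathcal{T}f,f)_H\geq0$ for all $f\in H$. $\mathbb{C}\in L(\mathcal{H})$ is a bounded linear operator on $\mathcal{H}$, $\mathbb{S}(t)=\exp(t\mathbb{C})$, and $\mathcal{Y}_0\in\mathcal{H}$. The mild solution is $\mathcal{Y}(t)=\mathbb{S}(t)\mathcal{Y}_0+\int_0^t\mathbb{S}(t-s)\,d\mathcal{L}(s)$, $t\ge0$. An $\mathcal{H}$-valued Lévy process $\mathcal{L}$ has non-decreasing paths if $\mathcal{L}(t)$ is self-adjoint and $t\mapsto(\mathcal{L}(t)f,f)_H$ is non-decreasing in $t\geq0$ for every $f\in H$, almost surely. *)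

theory Defs
  imports "HOL-Probability.Probability"
begin

section \<open>Orthonormal bases of a separable Hilbert space\<close>

text \<open>A real separable Hilbert space is a type of sort
  \<open>{real_inner, banach, second_countable_topology}\<close>.\<close>

definition orthonormal_basis :: "'h::real_inner set \<Rightarrow> bool" where
  "orthonormal_basis B \<longleftrightarrow>
     pairwise orthogonal B \<and> (\<forall>e\<in>B. norm e = 1) \<and> closure (span B) = UNIV"

fun gram_schmidt :: "(nat \<Rightarrow> 'h::real_inner) \<Rightarrow> nat \<Rightarrow> 'h" where
  "gram_schmidt d n = d n - (\<Sum>i<n. (d n \<bullet> gram_schmidt d i /
     (gram_schmidt d i \<bullet> gram_schmidt d i)) *\<^sub>R gram_schmidt d i)"

declare gram_schmidt.simps[simp del]

lemma gram_schmidt_orthogonal: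
  "j < n \<Longrightarrow> gram_schmidt d n \<bullet> gram_schmidt d j = 0"
proof (induction n arbitrary: j rule: less_induct)
  case (less n)
  let ?g = "gram_schmidt d"
  have orth: "?g i \<bullet> ?g j = 0" if "i < n" "i \<noteq> j" for i
    using less.IH[of i j] less.IH[of j i] less.prems that
    by (metis inner_commute nat_neq_iff)
  have "(\<Sum>i<n. (d n \<bullet> ?g i / (?g i \<bullet> ?g i)) * (?g i \<bullet> ?g j))
      = (\<Sum>i<n. if i = j then d n \<bullet> ?g j else 0)"
    by (rule sum.cong) (auto simp: orth)
  also have "\<dots> = d n \<bullet> ?g j"
    using less.prems by simp
  finally show ?case
    by (subst gram_schmidt.simps) (simp add: inner_diff_left inner_sum_left)
qed

lemma gram_schmidt_span: "d n \<in> span (range (gram_schmidt d))"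
proof -
  have "d n = gram_schmidt d n + (\<Sum>i<n. (d n \<bullet> gram_schmidt d i /
     (gram_schmidt d i \<bullet> gram_schmidt d i)) *\<^sub>R gram_schmidt d i)"
    using gram_schmidt.simps[of d n] by simp
  also have "\<dots> \<in> span (range (gram_schmidt d))"
    by (intro span_add span_sum span_scale span_base) auto
  finally show ?thesis .
qed

lemma orthonormal_basis_exists:
  "\<exists>B::'h::{real_inner, second_countable_topology} set. countable B \<and> orthonormal_basis B"
proof -
  obtain D :: "'h set" where D: "countable D"
    "\<And>X. open X \<Longrightarrow> X \<noteq> {} \<Longrightarrow> \<exists>y\<in>D. y \<in> X"
    using countable_dense_setE by blast
  have "D \<noteq> {}" using D(2)[of UNIV] by auto
  define d where "d = from_nat_into D"
  have rd: "range d = D" unfolding d_def using D(1) \<open>D \<noteq> {}\<close> by (simp add: range_from_nat_into)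
  define g where "g = gram_schmidt d"
  define B where "B = (\<lambda>n. g n /\<^sub>R norm (g n)) ` {n. g n \<noteq> 0}"
  have "pairwise orthogonal B"
  proof (rule pairwiseI)
    fix x y assume "x \<in> B" "y \<in> B" "x \<noteq> y"
    then obtain m n where mn: "x = g m /\<^sub>R norm (g m)" "y = g n /\<^sub>R norm (g n)" "m \<noteq> n"
      unfolding B_def by blast
    have "g m \<bullet> g n = 0"
      using gram_schmidt_orthogonal[of m n d] gram_schmidt_orthogonal[of n m d] mn(3)
      unfolding g_def by (metis inner_commute nat_neq_iff)
    thus "orthogonal x y" by (simp add: mn orthogonal_def)
  qed
  moreover have "\<forall>e\<in>B. norm e = 1" by (auto simp: B_def)
  moreover have "closure (span B) = UNIV"
  proof -
    have "g n \<in> span B" for n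
    proof (cases "g n = 0")
      case False
      hence "g n /\<^sub>R norm (g n) \<in> span B"
        by (intro span_base) (auto simp: B_def)
      hence "norm (g n) *\<^sub>R (g n /\<^sub>R norm (g n)) \<in> span B" by (rule span_scale)
      thus ?thesis using False by simp
    qed (simp add: span_zero)
    hence "span (range g) \<subseteq> span B"
      by (metis image_subsetI span_minimal subspace_span)
    hence "D \<subseteq> span B"
      using gram_schmidt_span[of d] rd unfolding g_def by blast
    moreover have "closure D = UNIV"
    proof -
      have "- closure D = {}"
      proof (rule ccontr)
        assume "- closure D \<noteq> {}"
        then obtain y where "y \<in> D" "y \<in> - closure D"
          using D(2)[of "- closure D"] by auto
        thus False using closure_subset[of D] by auto
      qed
      thus ?thesis by auto
    qed
    ultimately show ?thesis by (metis closure_mono top.extremum_uniqueI)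
  qed
  moreover have "countable B" unfolding B_def by simp
  ultimately show ?thesis unfolding orthonormal_basis_def by blast
qed

definition some_onb :: "'h::{real_inner, second_countable_topology} set" where
  "some_onb = (SOME B. countable B \<and> orthonormal_basis B)"

lemma some_onb: "countable some_onb" "orthonormal_basis some_onb"
  using someI_ex[OF orthonormal_basis_exists] unfolding some_onb_def by auto

lemma norm_onb: "orthonormal_basis B \<Longrightarrow> e \<in> B \<Longrightarrow> norm e = 1"
  by (simp add: orthonormal_basis_def)

lemma inner_onb: "orthonormal_basis B \<Longrightarrow> e \<in> B \<Longrightarrow> f \<in> B \<Longrightarrow> e \<bullet> f = (if e = f then 1 else 0)"
  by (auto simp: orthonormal_basis_def pairwise_def orthogonal_def norm_eq_1)


section \<open>The Hilbert space of Hilbert-Schmidt operators\<close>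

text \<open>The Hilbert-Schmidt property, inner product and norm do not depend on the
  orthonormal basis in which they are computed, so one basis is fixed.\<close>

definition hilbert_schmidt :: "('h::{real_inner, second_countable_topology} \<Rightarrow> 'h) \<Rightarrow> bool" where
  "hilbert_schmidt T \<longleftrightarrow> bounded_linear T \<and> (\<lambda>e. (norm (T e))\<^sup>2) summable_on some_onb"

lemma hs_summable_inner:
  assumes "(\<lambda>e. (norm (S e))\<^sup>2) summable_on A" "(\<lambda>e. (norm (T e))\<^sup>2) summable_on A"
  shows "(\<lambda>e. S e \<bullet> T e :: real) summable_on A"
proof -
  have "(\<lambda>e. norm (S e \<bullet> T e)) summable_on A"
  proof (rule summable_on_comparison_test)
    show "(\<lambda>e. (norm (S e))\<^sup>2 + (norm (T e))\<^sup>2) summable_on A"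
      by (rule summable_on_add[OF assms])
    fix e assume "e \<in> A"
    have "norm (S e \<bullet> T e) \<le> norm (S e) * norm (T e)" by (simp add: Cauchy_Schwarz_ineq2)
    also have "\<dots> \<le> (norm (S e))\<^sup>2 + (norm (T e))\<^sup>2"
      using sum_squares_bound[of "norm (S e)" "norm (T e)"]
        mult_nonneg_nonneg[OF norm_ge_zero[of "S e"] norm_ge_zero[of "T e"]]
      by linarith
    finally show "norm (S e \<bullet> T e) \<le> (norm (S e))\<^sup>2 + (norm (T e))\<^sup>2" .
  qed simp
  thus ?thesis by (rule abs_summable_summable)
qed

lemma hilbert_schmidt_add:
  assumes "hilbert_schmidt S" "hilbert_schmidt T"
  shows "hilbert_schmidt (\<lambda>x. S x + T x)"
proof -
  have s: "(\<lambda>e. (norm (S e))\<^sup>2) summable_on some_onb" "(\<lambda>e. (norm (T e))\<^sup>2) summable_on some_onb"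
    using assms by (auto simp: hilbert_schmidt_def)
  have "(\<lambda>e. ((norm (S e))\<^sup>2 + (norm (T e))\<^sup>2) + (S e \<bullet> T e + S e \<bullet> T e)) summable_on some_onb"
    by (intro summable_on_add s hs_summable_inner)
  also have "(\<lambda>e. ((norm (S e))\<^sup>2 + (norm (T e))\<^sup>2) + (S e \<bullet> T e + S e \<bullet> T e))
      = (\<lambda>e. (norm (S e + T e))\<^sup>2)"
    by (simp add: power2_norm_eq_inner inner_add_left inner_add_right inner_commute fun_eq_iff)
  finally show ?thesis using assms by (auto simp: hilbert_schmidt_def bounded_linear_add)
qed

lemma hilbert_schmidt_scaleR:
  assumes "hilbert_schmidt T"
  shows "hilbert_schmidt (\<lambda>x. r *\<^sub>R T x)"
  using assms
  by (auto simp: hilbert_schmidt_def power_mult_distrib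
      intro!: summable_on_cmult_right bounded_linear_const_scaleR)

lemma hilbert_schmidt_zero: "hilbert_schmidt (\<lambda>x. 0)"
  by (simp add: hilbert_schmidt_def)

lemma onb_norm_bound:
  fixes T :: "'h::real_inner \<Rightarrow> 'b::real_normed_vector"
  assumes B: "orthonormal_basis B" and T: "bounded_linear T"
    and K: "0 \<le> K" "\<And>F. finite F \<Longrightarrow> F \<subseteq> B \<Longrightarrow> (\<Sum>e\<in>F. (norm (T e))\<^sup>2) \<le> K\<^sup>2"
  shows "norm (T x) \<le> K * norm x"
proof -
  interpret T: bounded_linear T by (rule T)
  have *: "norm (T x) \<le> K * norm x" if xB: "x \<in> span B" for x
  proof -
    obtain F c where F: "finite F" "F \<subseteq> B" and x: "x = (\<Sum>e\<in>F. c e *\<^sub>R e)"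
      using xB unfolding span_explicit by blast
    have "(norm x)\<^sup>2 = (\<Sum>e\<in>F. \<Sum>f\<in>F. c e * (c f * (e \<bullet> f)))"
      unfolding x by (simp add: power2_norm_eq_inner inner_sum_left inner_sum_right sum_distrib_left inner_commute mult_ac)
    also have "\<dots> = (\<Sum>e\<in>F. \<Sum>f\<in>F. if e = f then (c e)\<^sup>2 else 0)"
      using F by (intro sum.cong refl) (auto simp: inner_onb[OF B] power2_eq_square subset_iff)
    also have "\<dots> = (\<Sum>e\<in>F. (c e)\<^sup>2)" using F by simp
    finally have nx: "norm x = L2_set c F" unfolding L2_set_def by (rule real_sqrt_unique[symmetric]) simp
    have "norm (T x) = norm (\<Sum>e\<in>F. c e *\<^sub>R T e)" by (simp add: x T.sum T.scaleR)
    also have "\<dots> \<le> (\<Sum>e\<in>F. \<bar>c e\<bar> * \<bar>norm (T e)\<bar>)" by (rule sum_norm_le) simp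
    also have "\<dots> \<le> L2_set c F * L2_set (\<lambda>e. norm (T e)) F" by (rule L2_set_mult_ineq)
    also have "\<dots> \<le> L2_set c F * K"
    proof (rule mult_left_mono)
      show "L2_set (\<lambda>e. norm (T e)) F \<le> K"
        unfolding L2_set_def by (rule real_le_lsqrt[OF K(1) K(2)[OF F]])
    qed simp
    finally show ?thesis unfolding nx by (simp only: mult.commute)
  qed
  have "closed {x. norm (T x) \<le> K * norm x}"
    by (intro closed_Collect_le continuous_intros linear_continuous_on T)
  hence "closure (span B) \<subseteq> {x. norm (T x) \<le> K * norm x}"
    using * by (intro closure_minimal) auto
  thus ?thesis using B by (auto simp: orthonormal_basis_def)
qed

typedef (overloaded) ('h::"{real_inner, banach, second_countable_topology}") hs_op =
  "{T :: 'h \<Rightarrow> 'h. hilbert_schmidt T}"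
  morphisms hs_apply Hs_op
  using hilbert_schmidt_zero by blast

setup_lifting type_definition_hs_op

lemma hilbert_schmidt_hs_apply: "hilbert_schmidt (hs_apply T)"
  using hs_apply by auto

lemma bounded_linear_hs_apply: "bounded_linear (hs_apply T)"
  using hilbert_schmidt_hs_apply by (auto simp: hilbert_schmidt_def)

lemma hs_summable: "(\<lambda>e. (norm (hs_apply T e))\<^sup>2) summable_on some_onb"
  using hilbert_schmidt_hs_apply by (auto simp: hilbert_schmidt_def)

lemma hs_op_eqI: "(\<And>x. hs_apply S x = hs_apply T x) \<Longrightarrow> S = T"
  by (metis ext hs_apply_inject)

instantiation hs_op :: ("{real_inner, banach, second_countable_topology}") real_inner
begin

lift_definition zero_hs_op :: "'a hs_op" is "\<lambda>x. 0" by (rule hilbert_schmidt_zero)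
lift_definition plus_hs_op :: "'a hs_op \<Rightarrow> 'a hs_op \<Rightarrow> 'a hs_op" is "\<lambda>S T x. S x + T x"
  by (rule hilbert_schmidt_add)
lift_definition scaleR_hs_op :: "real \<Rightarrow> 'a hs_op \<Rightarrow> 'a hs_op" is "\<lambda>r T x. r *\<^sub>R T x"
  by (rule hilbert_schmidt_scaleR)
lift_definition uminus_hs_op :: "'a hs_op \<Rightarrow> 'a hs_op" is "\<lambda>T x. - T x"
  using hilbert_schmidt_scaleR[where r="-1"] by simp
lift_definition minus_hs_op :: "'a hs_op \<Rightarrow> 'a hs_op \<Rightarrow> 'a hs_op" is "\<lambda>S T x. S x - T x"
  using hilbert_schmidt_add[OF _ hilbert_schmidt_scaleR[where r="-1"]] by simp

definition inner_hs_op :: "'a hs_op \<Rightarrow> 'a hs_op \<Rightarrow> real" where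
  "inner_hs_op S T = (\<Sum>\<^sub>\<infinity>e\<in>some_onb. hs_apply S e \<bullet> hs_apply T e)"

definition norm_hs_op :: "'a hs_op \<Rightarrow> real" where
  "norm_hs_op T = sqrt (T \<bullet> T)"
definition dist_hs_op :: "'a hs_op \<Rightarrow> 'a hs_op \<Rightarrow> real" where
  "dist_hs_op S T = norm (S - T)"
definition sgn_hs_op :: "'a hs_op \<Rightarrow> 'a hs_op" where
  "sgn_hs_op T = scaleR (inverse (norm T)) T"
definition uniformity_hs_op :: "('a hs_op \<times> 'a hs_op) filter" where
  "uniformity_hs_op = (INF e\<in>{0 <..}. principal {(x, y). dist x y < e})"
definition open_hs_op :: "'a hs_op set \<Rightarrow> bool" where
  "open_hs_op U = (\<forall>x\<in>U. \<forall>\<^sub>F (x', y) in uniformity. x' = x \<longrightarrow> y \<in> U)"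

instance
proof
  fix R S T :: "'a hs_op" and a b :: real and U :: "'a hs_op set"
  note lin = bounded_linear_hs_apply
  have sum: "(\<lambda>e. hs_apply S e \<bullet> hs_apply T e) summable_on some_onb" for S T :: "'a hs_op"
    by (intro hs_summable_inner hs_summable)
  show "R + S + T = R + (S + T)" by transfer (simp add: add.assoc)
  show "R + S = S + R" by transfer (simp add: add.commute)
  show "0 + R = R" by transfer simp
  show "- R + R = 0" by transfer simp
  show "R - S = R + - S" by transfer simp
  show "a *\<^sub>R (R + S) = a *\<^sub>R R + a *\<^sub>R S" by transfer (simp add: scaleR_add_right)
  show "(a + b) *\<^sub>R R = a *\<^sub>R R + b *\<^sub>R R" by transfer (simp add: scaleR_add_left)
  show "a *\<^sub>R b *\<^sub>R R = (a * b) *\<^sub>R R" by transfer simp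
  show "1 *\<^sub>R R = R" by transfer simp
  show "dist R S = norm (R - S)" by (rule dist_hs_op_def)
  show "sgn R = scaleR (inverse (norm R)) R" by (rule sgn_hs_op_def)
  show "uniformity = (INF e\<in>{0 <..}. principal {(x, y :: 'a hs_op). dist x y < e})"
    by (rule uniformity_hs_op_def)
  show "open U = (\<forall>x\<in>U. \<forall>\<^sub>F (x', y) in uniformity. x' = x \<longrightarrow> y \<in> U)"
    by (rule open_hs_op_def)
  show "R \<bullet> S = S \<bullet> R" by (simp add: inner_hs_op_def inner_commute)
  show "(R + S) \<bullet> T = R \<bullet> T + S \<bullet> T"
    by (simp add: inner_hs_op_def plus_hs_op.rep_eq inner_add_left infsum_add sum)
  show "(a *\<^sub>R R) \<bullet> S = a * (R \<bullet> S)"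
    by (simp add: inner_hs_op_def scaleR_hs_op.rep_eq infsum_cmult_right')
  show "0 \<le> R \<bullet> R" by (simp add: inner_hs_op_def infsum_nonneg)
  show "norm R = sqrt (R \<bullet> R)" by (rule norm_hs_op_def)
  show "(R \<bullet> R = 0) = (R = 0)"
  proof
    assume 0: "R \<bullet> R = 0"
    have z: "norm (hs_apply R e) = 0" if "e \<in> some_onb" for e
    proof -
      have "hs_apply R e \<bullet> hs_apply R e = 0"
        by (rule nonneg_infsum_le_0D[where A=some_onb and f="\<lambda>e. hs_apply R e \<bullet> hs_apply R e"])
          (use 0 that in \<open>simp_all add: inner_hs_op_def sum\<close>)
      thus ?thesis by simp
    qed
    have "norm (hs_apply R x) \<le> 0 * norm x" for x
    proof (rule onb_norm_bound[OF some_onb(2) lin])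
      fix F :: "'a set" assume "F \<subseteq> some_onb"
      hence "(\<Sum>e\<in>F. (norm (hs_apply R e))\<^sup>2) = (\<Sum>e\<in>F. 0)"
        using z by (intro sum.cong) (auto simp: subset_iff)
      thus "(\<Sum>e\<in>F. (norm (hs_apply R e))\<^sup>2) \<le> 0\<^sup>2" by simp
    qed simp
    thus "R = 0" by (intro hs_op_eqI) (simp add: zero_hs_op.rep_eq)
  next
    show "R = 0 \<Longrightarrow> R \<bullet> R = 0" by (simp add: inner_hs_op_def zero_hs_op.rep_eq)
  qed
qed

end

lemma norm_hs_op_power2: "(norm T)\<^sup>2 = (\<Sum>\<^sub>\<infinity>e\<in>some_onb. (norm (hs_apply T e))\<^sup>2)"
  by (simp add: power2_norm_eq_inner inner_hs_op_def)

lemma hs_finite_sum_le: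
  assumes "finite F" "F \<subseteq> some_onb"
  shows "(\<Sum>e\<in>F. (norm (hs_apply T e))\<^sup>2) \<le> (norm T)\<^sup>2"
  unfolding norm_hs_op_power2 by (rule finite_sum_le_infsum[OF hs_summable assms]) simp

lemma norm_hs_apply: "norm (hs_apply T x) \<le> norm T * norm x"
  by (rule onb_norm_bound[OF some_onb(2) bounded_linear_hs_apply norm_ge_zero hs_finite_sum_le])

lemma bounded_bilinear_hs_apply: "bounded_bilinear hs_apply"
proof
  fix S T :: "'a hs_op" and x y :: 'a and r :: real
  interpret bounded_linear "hs_apply T" by (rule bounded_linear_hs_apply)
  show "hs_apply (S + T) x = hs_apply S x + hs_apply T x" by (simp add: plus_hs_op.rep_eq)
  show "hs_apply (r *\<^sub>R T) x = r *\<^sub>R hs_apply T x" by (simp add: scaleR_hs_op.rep_eq)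
  show "hs_apply T (x + y) = hs_apply T x + hs_apply T y" by (rule add)
  show "hs_apply T (r *\<^sub>R x) = r *\<^sub>R hs_apply T x" by (rule scaleR)
  show "\<exists>K. \<forall>T x. norm (hs_apply T x) \<le> norm (T :: 'a hs_op) * norm x * K"
    by (rule exI[of _ 1]) (simp add: norm_hs_apply)
qed

instance hs_op :: ("{real_inner, banach, second_countable_topology}") banach
proof
  fix X :: "nat \<Rightarrow> 'a hs_op"
  assume X: "Cauchy X"
  interpret ap: bounded_bilinear "hs_apply :: 'a hs_op \<Rightarrow> _" by (rule bounded_bilinear_hs_apply)
  have "convergent (\<lambda>n. hs_apply (X n) x)" for x
    using bounded_linear.Cauchy[OF ap.bounded_linear_left X] by (simp add: Cauchy_convergent_iff)
  then obtain v where v: "\<And>x. (\<lambda>n. hs_apply (X n) x) \<longlonglongrightarrow> v x"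
    unfolding convergent_def by metis
  obtain K where K: "\<And>n. norm (X n) \<le> K"
    using Cauchy_Bseq[OF X] by (meson BseqE)
  have K0: "0 \<le> K" using norm_ge_zero K by (rule order_trans)
  have blv: "bounded_linear v"
  proof (rule bounded_linear_intro)
    show "v (x + y) = v x + v y" for x y
      using LIMSEQ_unique[OF v[of "x + y"]] tendsto_add[OF v[of x] v[of y]] by (simp add: ap.add_right)
    show "v (r *\<^sub>R x) = r *\<^sub>R v x" for r x
      using LIMSEQ_unique[OF v[of "r *\<^sub>R x"]] tendsto_scaleR[OF tendsto_const[of r] v[of x]]
      by (simp add: ap.scaleR_right)
    show "norm (v x) \<le> norm x * K" for x
    proof (rule LIMSEQ_le_const2[OF tendsto_norm[OF v]], intro exI allI impI)
      fix n
      have "norm (hs_apply (X n) x) \<le> norm (X n) * norm x" by (rule norm_hs_apply)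
      also have "\<dots> \<le> K * norm x" by (rule mult_right_mono[OF K norm_ge_zero])
      finally show "norm (hs_apply (X n) x) \<le> norm x * K" by (simp add: mult.commute)
    qed
  qed
  have fin: "(\<Sum>e\<in>F. (norm (hs_apply (X n) e - v e))\<^sup>2) \<le> r\<^sup>2"
    if F: "finite F" "F \<subseteq> some_onb" and M: "\<And>m. m \<ge> M \<Longrightarrow> norm (X n - X m) \<le> r" for F n r M
  proof (rule LIMSEQ_le_const2)
    show "(\<lambda>m. \<Sum>e\<in>F. (norm (hs_apply (X n) e - hs_apply (X m) e))\<^sup>2)
        \<longlonglongrightarrow> (\<Sum>e\<in>F. (norm (hs_apply (X n) e - v e))\<^sup>2)"
      by (intro tendsto_intros v)
    show "\<exists>N. \<forall>m\<ge>N. (\<Sum>e\<in>F. (norm (hs_apply (X n) e - hs_apply (X m) e))\<^sup>2) \<le> r\<^sup>2"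
    proof (intro exI allI impI)
      fix m assume "M \<le> m"
      have "(\<Sum>e\<in>F. (norm (hs_apply (X n) e - hs_apply (X m) e))\<^sup>2) \<le> (norm (X n - X m))\<^sup>2"
        using hs_finite_sum_le[OF F, of "X n - X m"] by (simp add: ap.diff_left)
      also have "\<dots> \<le> r\<^sup>2" by (rule power_mono[OF M[OF \<open>M \<le> m\<close>] norm_ge_zero])
      finally show "(\<Sum>e\<in>F. (norm (hs_apply (X n) e - hs_apply (X m) e))\<^sup>2) \<le> r\<^sup>2" .
    qed
  qed
  have "hilbert_schmidt (\<lambda>x. hs_apply (X 0) x - v x)"
    unfolding hilbert_schmidt_def
  proof
    show "bounded_linear (\<lambda>x. hs_apply (X 0) x - v x)"
      by (rule bounded_linear_sub[OF bounded_linear_hs_apply blv])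
    have "norm (X 0 - X m) \<le> 2 * K" for m
      using norm_triangle_ineq4[of "X 0" "X m"] K[of 0] K[of m] by simp
    hence "\<And>F. finite F \<Longrightarrow> F \<subseteq> some_onb \<Longrightarrow>
        (\<Sum>e\<in>F. (norm (hs_apply (X 0) e - v e))\<^sup>2) \<le> (2 * K)\<^sup>2"
      by (intro fin) auto
    thus "(\<lambda>e. (norm (hs_apply (X 0) e - v e))\<^sup>2) summable_on some_onb"
      by (intro nonneg_bdd_above_summable_on bdd_aboveI[where M="(2 * K)\<^sup>2"]) auto
  qed
  from hilbert_schmidt_add[OF hilbert_schmidt_hs_apply[of "X 0"] hilbert_schmidt_scaleR[OF this, of "-1"]]
  have hv: "hilbert_schmidt v" by simp
  define V where "V = Hs_op v"
  have V: "hs_apply V = v" unfolding V_def using hv by (simp add: Hs_op_inverse)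
  have "X \<longlonglongrightarrow> V"
  proof (rule LIMSEQ_I)
    fix r :: real assume "0 < r"
    then obtain M where M: "\<And>m n. m \<ge> M \<Longrightarrow> n \<ge> M \<Longrightarrow> norm (X m - X n) < r / 2"
      using CauchyD[OF X, of "r / 2"] by auto
    show "\<exists>N. \<forall>n\<ge>N. norm (X n - V) < r"
    proof (intro exI allI impI)
      fix n assume n: "M \<le> n"
      have "(norm (X n - V))\<^sup>2 \<le> (r / 2)\<^sup>2"
        unfolding norm_hs_op_power2
      proof (rule infsum_le_finite_sums[OF hs_summable])
        fix F :: "'a set" assume F: "finite F" "F \<subseteq> some_onb"
        have "(\<Sum>e\<in>F. (norm (hs_apply (X n) e - v e))\<^sup>2) \<le> (r / 2)\<^sup>2"
          using M[OF n] by (intro fin[OF F, where M=M]) (auto intro: less_imp_le)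
        thus "(\<Sum>e\<in>F. (norm (hs_apply (X n - V) e))\<^sup>2) \<le> (r / 2)\<^sup>2"
          by (simp add: ap.diff_left V)
      qed
      hence "norm (X n - V) \<le> r / 2" using \<open>0 < r\<close> by (simp add: power2_le_iff_abs_le)
      thus "norm (X n - V) < r" using \<open>0 < r\<close> by simp
    qed
  qed
  thus "convergent X" by (rule convergentI)
qed

text \<open>Separability: finite sums of rank-one operators \<open>x \<mapsto> (e, x) d\<close>, with \<open>e\<close> in the basis and
  \<open>d\<close> in a countable dense set, are dense.\<close>

lemma hilbert_schmidt_rank_one:
  fixes d :: "'h::{real_inner, banach, second_countable_topology}"
  assumes "e \<in> some_onb"
  shows "hilbert_schmidt (\<lambda>x. (e \<bullet> x) *\<^sub>R d)"
  unfolding hilbert_schmidt_def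
proof
  show "bounded_linear (\<lambda>x. (e \<bullet> x) *\<^sub>R d)"
    by (intro bounded_linear_scaleR_const bounded_linear_inner_right)
  have "(\<lambda>f. (norm ((e \<bullet> f) *\<^sub>R d))\<^sup>2) summable_on some_onb \<longleftrightarrow>
      (\<lambda>f. (norm ((e \<bullet> f) *\<^sub>R d))\<^sup>2) summable_on {e}"
    using assms by (intro summable_on_cong_neutral) (auto simp: inner_onb[OF some_onb(2)])
  thus "(\<lambda>f. (norm ((e \<bullet> f) *\<^sub>R d))\<^sup>2) summable_on some_onb" by simp
qed

lift_definition rank_one :: "'h::{real_inner, banach, second_countable_topology} \<Rightarrow> 'h \<Rightarrow> 'h hs_op" is
  "\<lambda>e d x. if e \<in> some_onb then (e \<bullet> x) *\<^sub>R d else 0"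
  subgoal for e d
    by (cases "e \<in> some_onb") (simp_all add: hilbert_schmidt_rank_one hilbert_schmidt_zero)
  done

lemma hs_finite_rank_dense:
  fixes T :: "'h::{real_inner, banach, second_countable_topology} hs_op" and D :: "'h set"
  assumes D: "\<And>X. open X \<Longrightarrow> X \<noteq> {} \<Longrightarrow> \<exists>y\<in>D. y \<in> X" and "0 < r"
  shows "\<exists>xs\<in>lists (some_onb \<times> D). norm (T - (\<Sum>(e, d)\<leftarrow>xs. rank_one e d)) < r"
proof -
  interpret ap: bounded_bilinear "hs_apply :: 'h hs_op \<Rightarrow> _" by (rule bounded_bilinear_hs_apply)
  define s where "s = r\<^sup>2 / 4"
  have s: "0 < s" using \<open>0 < r\<close> by (simp add: s_def)
  obtain F where F: "finite F" "F \<subseteq> some_onb"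
    and Fs: "dist (\<Sum>e\<in>F. (norm (hs_apply T e))\<^sup>2) ((norm T)\<^sup>2) \<le> s"
    unfolding norm_hs_op_power2 using infsum_finite_approximation[OF hs_summable s] by blast
  define q where "q = sqrt (s / (real (card F) + 1))"
  have q: "0 < q" using s by (simp add: q_def)
  have "\<exists>y\<in>D. y \<in> ball (hs_apply T e) q" for e
    using D[of "ball (hs_apply T e) q"] q by auto
  then obtain d where d: "\<And>e. d e \<in> D" "\<And>e. dist (hs_apply T e) (d e) < q"
    by (metis mem_ball)
  obtain es where es: "set es = F" "distinct es" using finite_distinct_list[OF F(1)] by blast
  define xs where "xs = map (\<lambda>e. (e, d e)) es"
  define R where "R = (\<Sum>(e, d)\<leftarrow>xs. rank_one e d)"
  have R: "R = (\<Sum>e\<in>F. rank_one e (d e))"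
    unfolding R_def xs_def by (simp add: o_def sum_list_distinct_conv_sum_set es)
  have Rap: "hs_apply R e = (if e \<in> F then d e else 0)" if "e \<in> some_onb" for e
  proof -
    have "hs_apply R e = (\<Sum>f\<in>F. hs_apply (rank_one f (d f)) e)" by (simp add: R ap.sum_left)
    also have "\<dots> = (\<Sum>f\<in>F. if f = e then d e else 0)"
      using F that by (intro sum.cong) (auto simp: rank_one.rep_eq inner_onb[OF some_onb(2)])
    also have "\<dots> = (if e \<in> F then d e else 0)" using F by simp
    finally show ?thesis .
  qed
  have "(norm (T - R))\<^sup>2 \<le> 2 * s"
    unfolding norm_hs_op_power2
  proof (rule infsum_le_finite_sums[OF hs_summable])
    fix G :: "'h set" assume G: "finite G" "G \<subseteq> some_onb"
    have "(\<Sum>e\<in>G. (norm (hs_apply (T - R) e))\<^sup>2) \<le> (\<Sum>e\<in>G \<union> F. (norm (hs_apply (T - R) e))\<^sup>2)"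
      using G F by (intro sum_mono2) auto
    also have "G \<union> F = F \<union> (G - F)" by auto
    also have "(\<Sum>e\<in>F \<union> (G - F). (norm (hs_apply (T - R) e))\<^sup>2)
        = (\<Sum>e\<in>F. (norm (hs_apply (T - R) e))\<^sup>2) + (\<Sum>e\<in>G - F. (norm (hs_apply (T - R) e))\<^sup>2)"
      using F G by (intro sum.union_disjoint) auto
    also have "(\<Sum>e\<in>F. (norm (hs_apply (T - R) e))\<^sup>2) \<le> (\<Sum>e\<in>F. s / (real (card F) + 1))"
    proof (rule sum_mono)
      fix e assume "e \<in> F"
      hence "norm (hs_apply (T - R) e) \<le> q"
        using F d(2)[of e] by (auto simp: ap.diff_left Rap dist_norm subset_iff)
      hence "(norm (hs_apply (T - R) e))\<^sup>2 \<le> q\<^sup>2" by (intro power_mono) auto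
      thus "(norm (hs_apply (T - R) e))\<^sup>2 \<le> s / (real (card F) + 1)" using s by (simp add: q_def)
    qed
    also have "\<dots> \<le> s" using s by (simp add: field_simps)
    also have "(\<Sum>e\<in>G - F. (norm (hs_apply (T - R) e))\<^sup>2) = (\<Sum>e\<in>G - F. (norm (hs_apply T e))\<^sup>2)"
      using G by (intro sum.cong) (auto simp: ap.diff_left Rap subset_iff)
    also have "\<dots> \<le> s"
    proof -
      have "(\<Sum>e\<in>F \<union> (G - F). (norm (hs_apply T e))\<^sup>2) \<le> (norm T)\<^sup>2"
        using F G by (intro hs_finite_sum_le) auto
      also have "(\<Sum>e\<in>F \<union> (G - F). (norm (hs_apply T e))\<^sup>2)
          = (\<Sum>e\<in>F. (norm (hs_apply T e))\<^sup>2) + (\<Sum>e\<in>G - F. (norm (hs_apply T e))\<^sup>2)"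
        using F G by (intro sum.union_disjoint) auto
      finally show ?thesis using Fs by (auto simp: dist_real_def abs_if split: if_splits)
    qed
    finally show "(\<Sum>e\<in>G. (norm (hs_apply (T - R) e))\<^sup>2) \<le> 2 * s" by simp
  qed
  also have "\<dots> < r\<^sup>2" using \<open>0 < r\<close> by (simp add: s_def)
  finally have "norm (T - R) < r" using \<open>0 < r\<close> by (simp add: power_less_imp_less_base)
  moreover have "xs \<in> lists (some_onb \<times> D)" using d(1) es F by (auto simp: xs_def)
  ultimately show ?thesis unfolding R_def by blast
qed

lemma hs_countable_dense:
  "\<exists>A :: 'h::{real_inner, banach, second_countable_topology} hs_op set.
     countable A \<and> (\<forall>T r. 0 < r \<longrightarrow> (\<exists>S\<in>A. dist T S < r))"
proof -
  obtain D :: "'h set" where D: "countable D"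
    "\<And>X. open X \<Longrightarrow> X \<noteq> {} \<Longrightarrow> \<exists>y\<in>D. y \<in> X"
    using countable_dense_setE by blast
  have "countable ((\<lambda>xs. \<Sum>(e, d)\<leftarrow>xs. rank_one e d) ` lists (some_onb \<times> D))"
    using D(1) some_onb(1) by (intro countable_image countable_lists countable_SIGMA) auto
  thus ?thesis using hs_finite_rank_dense[OF D(2)] by (force simp: dist_norm)
qed

instance hs_op :: ("{real_inner, banach, second_countable_topology}") second_countable_topology
proof
  obtain A :: "'a hs_op set" where A: "countable A" "\<And>T r. 0 < r \<Longrightarrow> \<exists>S\<in>A. dist T S < r"
    using hs_countable_dense by blast
  define BB where "BB = (\<lambda>(S, n). ball S (1 / real (Suc n))) ` (A \<times> UNIV)"
  have "topological_basis BB"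
  proof (rule topological_basisI)
    show "open B" if "B \<in> BB" for B using that by (auto simp: BB_def)
    fix U and T :: "'a hs_op" assume U: "open U" "T \<in> U"
    then obtain r where r: "0 < r" "ball T r \<subseteq> U" by (meson open_contains_ball)
    obtain n where n: "1 / real (Suc n) < r / 2"
      using reals_Archimedean[of "r / 2"] r by (auto simp: inverse_eq_divide)
    obtain S where S: "S \<in> A" "dist T S < 1 / real (Suc n)" using A(2)[of "1 / real (Suc n)" T] by auto
    have "ball S (1 / real (Suc n)) \<subseteq> ball T r"
    proof
      fix x assume "x \<in> ball S (1 / real (Suc n))"
      hence "dist S x < 1 / real (Suc n)" by simp
      with S n dist_triangle[of T x S] show "x \<in> ball T r" by simp
    qed
    thus "\<exists>B'\<in>BB. T \<in> B' \<and> B' \<subseteq> U"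
      using S r by (intro bexI[of _ "ball S (1 / real (Suc n))"]) (auto simp: BB_def dist_commute)
  qed
  moreover have "countable BB" unfolding BB_def using A(1) by auto
  ultimately show "\<exists>B::'a hs_op set set. countable B \<and> open = generate_topology B"
    using topological_basis_imp_subbasis by blast
qed

definition hs_self_adjoint :: "'h::{real_inner, banach, second_countable_topology} hs_op \<Rightarrow> bool" where
  "hs_self_adjoint T \<longleftrightarrow> (\<forall>f g. hs_apply T f \<bullet> g = f \<bullet> hs_apply T g)"

text \<open>Non-negative definiteness does not include self-adjointness.\<close>

definition hs_nonneg :: "'h::{real_inner, banach, second_countable_topology} hs_op \<Rightarrow> bool" where
  "hs_nonneg T \<longleftrightarrow> (\<forall>f. 0 \<le> hs_apply T f \<bullet> f)"

definition hs_cone :: "'h::{real_inner, banach, second_countable_topology} hs_op set" where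
  "hs_cone = {T. hs_nonneg T}"


section \<open>Exponential of a bounded operator\<close>

text \<open>The type \<open>'a \<Rightarrow>\<^sub>L 'a\<close> carries no multiplication, so \<open>exp\<close> is not available for it.\<close>

definition blinfun_exp :: "('a::real_normed_vector \<Rightarrow>\<^sub>L 'a) \<Rightarrow> ('a \<Rightarrow>\<^sub>L 'a)" where
  "blinfun_exp A = (\<Sum>n. (((o\<^sub>L) A ^^ n) id_blinfun) /\<^sub>R fact n)"


section \<open>Levy processes\<close>

locale levy_process = prob_space M
  for M :: "'w measure"
    and L :: "real \<Rightarrow> 'w \<Rightarrow> 'a::{real_normed_vector, second_countable_topology}" +
  assumes random_variable_levy: "0 \<le> t \<Longrightarrow> L t \<in> borel_measurable M"
    and start_zero: "AE \<omega> in M. L 0 \<omega> = 0"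
    and independent_increments:
      "0 \<le> \<tau> 0 \<Longrightarrow> (\<And>i. i < n \<Longrightarrow> \<tau> i \<le> \<tau> (Suc i)) \<Longrightarrow>
        indep_vars (\<lambda>_. borel) (\<lambda>i \<omega>. L (\<tau> (Suc i)) \<omega> - L (\<tau> i) \<omega>) {..<n}"
    and stationary_increments:
      "0 \<le> s \<Longrightarrow> s \<le> t \<Longrightarrow> distr M borel (\<lambda>\<omega>. L t \<omega> - L s \<omega>) = distr M borel (L (t - s))"
    and stochastically_continuous:
      "0 \<le> s \<Longrightarrow> 0 < \<epsilon> \<Longrightarrow>
        ((\<lambda>t. prob {\<omega> \<in> space M. \<epsilon> < norm (L t \<omega> - L s \<omega>)}) \<longlongrightarrow> 0) (at s within {0..})"

definition square_integrable_process ::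
    "'w measure \<Rightarrow> (real \<Rightarrow> 'w \<Rightarrow> 'a::{real_normed_vector, second_countable_topology}) \<Rightarrow> bool" where
  "square_integrable_process M L \<longleftrightarrow>
     (\<forall>t\<ge>0. L t \<in> borel_measurable M \<and> integrable M (\<lambda>\<omega>. (norm (L t \<omega>))\<^sup>2))"

definition non_decreasing_paths ::
    "'w measure \<Rightarrow> (real \<Rightarrow> 'w \<Rightarrow> 'h::{real_inner, banach, second_countable_topology} hs_op) \<Rightarrow> bool" where
  "non_decreasing_paths M L \<longleftrightarrow>
     (AE \<omega> in M. (\<forall>t\<ge>0. hs_self_adjoint (L t \<omega>)) \<and>
                 (\<forall>f. mono_on {0..} (\<lambda>t. hs_apply (L t \<omega>) f \<bullet> f)))"


section \<open>Stochastic integral of a deterministic operator-valued integrand\<close>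

text \<open>The integral over \<open>(0, t]\<close> is defined on step functions
  \<open>\<Sum>i<n. A i 1_(\<tau> i, \<tau> (i+1)]\<close> in the obvious way and extended by \<open>L\<^sup>2\<close> limits. For a square
  integrable Levy process with mean \<open>t m\<close> the integral of step functions is continuous from
  \<open>L\<^sup>2(0, t)\<close> (with operator norm) to \<open>L\<^sup>2(M)\<close>, so the limit is a.s. unique and independent of the
  approximating sequence. It is the sum of the integral against the martingale \<open>L(s) - s m\<close>
  and the Bochner integral against \<open>m ds\<close>.\<close>

definition partition_of :: "real \<Rightarrow> nat \<Rightarrow> (nat \<Rightarrow> real) \<Rightarrow> bool" where
  "partition_of t n \<tau> \<longleftrightarrow> 0 \<le> \<tau> 0 \<and> (\<forall>i<n. \<tau> i \<le> \<tau> (Suc i)) \<and> \<tau> n \<le> t"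

definition step_function ::
    "nat \<Rightarrow> (nat \<Rightarrow> real) \<Rightarrow> (nat \<Rightarrow> 'a::real_normed_vector \<Rightarrow>\<^sub>L 'b::real_normed_vector) \<Rightarrow> real \<Rightarrow> 'a \<Rightarrow>\<^sub>L 'b"
  where
  "step_function n \<tau> A s = (\<Sum>i<n. indicator {\<tau> i<..\<tau> (Suc i)} s *\<^sub>R A i)"

definition step_integral ::
    "(real \<Rightarrow> 'w \<Rightarrow> 'a) \<Rightarrow> nat \<Rightarrow> (nat \<Rightarrow> real) \<Rightarrow>
      (nat \<Rightarrow> 'a::real_normed_vector \<Rightarrow>\<^sub>L 'b::real_normed_vector) \<Rightarrow> 'w \<Rightarrow> 'b" where
  "step_integral L n \<tau> A \<omega> = (\<Sum>i<n. A i (L (\<tau> (Suc i)) \<omega> - L (\<tau> i) \<omega>))"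

text \<open>The first measurability requirement is needed because the nonnegative integral of a
  non-measurable function is only a lower integral.\<close>

definition has_stochastic_integral ::
    "'w measure \<Rightarrow> (real \<Rightarrow> 'w \<Rightarrow> 'a) \<Rightarrow> real \<Rightarrow>
      (real \<Rightarrow> 'a::real_normed_vector \<Rightarrow>\<^sub>L 'b::real_normed_vector) \<Rightarrow> ('w \<Rightarrow> 'b) \<Rightarrow> bool" where
  "has_stochastic_integral M L t \<Phi> Z \<longleftrightarrow>
     \<Phi> \<in> borel_measurable (restrict_space lborel {0..t}) \<and> Z \<in> borel_measurable M \<and>
     (\<exists>n \<tau> A. (\<forall>k. partition_of t (n k) (\<tau> k)) \<and>
        (\<lambda>k. \<integral>\<^sup>+s\<in>{0..t}. ennreal ((norm (\<Phi> s - step_function (n k) (\<tau> k) (A k) s))\<^sup>2) \<partial>lborel)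
          \<longlonglongrightarrow> 0 \<and>
        (\<lambda>k. \<integral>\<^sup>+\<omega>. ennreal ((norm (step_integral L (n k) (\<tau> k) (A k) \<omega> - Z \<omega>))\<^sup>2) \<partial>M)
          \<longlonglongrightarrow> 0)"

definition mild_solution ::
    "'w measure \<Rightarrow> ('a::{real_normed_vector, second_countable_topology} \<Rightarrow>\<^sub>L 'a) \<Rightarrow>
      (real \<Rightarrow> 'w \<Rightarrow> 'a) \<Rightarrow> 'a \<Rightarrow> (real \<Rightarrow> 'w \<Rightarrow> 'a) \<Rightarrow> bool" where
  "mild_solution M C L Y0 Y \<longleftrightarrow>
     (\<forall>t\<ge>0. Y t \<in> borel_measurable M \<and>
       (\<exists>Z. has_stochastic_integral M L t (\<lambda>s. blinfun_exp ((t - s) *\<^sub>R C)) Z \<and>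
            (AE \<omega> in M. Y t \<omega> = blinfun_exp (t *\<^sub>R C) Y0 + Z \<omega>)))"

end

theory Submission
  imports Defs
begin

text \<open>Fix \<open>f\<close>. The definition of the stochastic integral allows step functions with arbitrary
  operator values \<open>A\<^sub>i\<close>, which need not preserve the cone. On each interval of the partition some
  value \<open>\<Phi>(\<sigma>\<^sub>i)\<close> of \<open>\<Phi>(s) = exp((t - s)C)\<close> is, up to \<open>\<epsilon>\<close>, at most as far from \<open>A\<^sub>i\<close> as \<open>\<Phi>\<close> is on
  average, so replacing \<open>A\<^sub>i\<close> by \<open>\<Phi>(\<sigma>\<^sub>i)\<close> keeps the \<open>L\<^sup>2\<close> convergence of the integrands. The
  functional \<open>\<phi> = (\<cdot> f, f)\<close> of the difference of the two step integrals is a sum of scalar functionals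
  of independent increments; since means and variances of functionals of \<open>L(t)\<close> are linear in \<open>t\<close>,
  it tends to 0 in \<open>L\<^sup>2\<close>. The modified step integrals have non-negative \<open>\<phi>\<close> because \<open>\<Phi>(s)\<close> preserves
  the cone and the increments lie in it. Hence the integral \<open>Z\<close> satisfies \<open>(Z f, f) \<ge> 0\<close> almost
  surely, simultaneously for all \<open>f\<close> in a countable dense set.\<close>

section \<open>Second moments of functionals of a Levy process\<close>

text \<open>Cauchy's functional equation: additivity and non-negativity make \<open>h\<close>
  monotone, and squeezing \<open>n * t\<close> between consecutive integers leaves an error of at
  most \<open>h 1 / n\<close>. It is applied to variances and means as functions of time.\<close>

lemma additive_nonneg_imp_linear:
  fixes h :: "real \<Rightarrow> real"
  assumes add: "\<And>s t. 0 \<le> s \<Longrightarrow> 0 \<le> t \<Longrightarrow> h (s + t) = h s + h t"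
    and nonneg: "\<And>t. 0 \<le> t \<Longrightarrow> 0 \<le> h t" and "0 \<le> t"
  shows "h t = t * h 1"
proof -
  have h0: "h 0 = 0" using add[of 0 0] by simp
  have mult: "h (real n * s) = real n * h s" if "0 \<le> s" for n s
  proof (induction n)
    case (Suc n)
    have "h (real (Suc n) * s) = h (real n * s + s)" by (simp add: algebra_simps)
    also have "\<dots> = h (real n * s) + h s" using that by (intro add) auto
    finally show ?case using Suc by (simp add: algebra_simps)
  qed (simp add: h0)
  have mono: "h s \<le> h t" if "0 \<le> s" "s \<le> t" for s t
    using add[of s "t - s"] nonneg[of "t - s"] that by simp
  have bound: "\<bar>h t - t * h 1\<bar> * real n \<le> h 1" for n
  proof -
    \<comment> \<open>With this \<open>k\<close>, both \<open>n * h t\<close> and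
      \<open>n * t * h 1\<close> lie between \<open>k * h 1\<close> and
      \<open>(k + 1) * h 1\<close>, so they differ by at most \<open>h 1\<close>.\<close>
    define k where "k = nat \<lfloor>real n * t\<rfloor>"
    have k: "real k \<le> real n * t" "real n * t \<le> real k + 1"
      using \<open>0 \<le> t\<close> unfolding k_def by simp_all
    have "real k * h 1 \<le> real n * h t"
      using mono[of "real k" "real n * t"] k mult[of 1 k] mult[of t n] \<open>0 \<le> t\<close> by simp
    moreover have "real n * h t \<le> (real k + 1) * h 1"
      using mono[of "real n * t" "real (Suc k)"] k mult[of 1 "Suc k"] mult[of t n] \<open>0 \<le> t\<close>
      by (simp add: algebra_simps)
    moreover have "real k * h 1 \<le> real n * t * h 1" "real n * t * h 1 \<le> (real k + 1) * h 1"
      using k nonneg[of 1] by (auto intro!: mult_right_mono)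
    ultimately have "\<bar>real n * h t - real n * t * h 1\<bar> \<le> h 1"
      by (simp add: algebra_simps abs_le_iff)
    also have "real n * h t - real n * t * h 1 = (h t - t * h 1) * real n"
      by (simp add: algebra_simps)
    finally show ?thesis by (simp add: abs_mult)
  qed
  show ?thesis
  proof (rule ccontr)
    assume "h t \<noteq> t * h 1"
    then obtain n where "h 1 < real n * \<bar>h t - t * h 1\<bar>"
      using reals_Archimedean3[of "\<bar>h t - t * h 1\<bar>"] by auto
    with bound[of n] show False by (simp add: mult.commute)
  qed
qed

text \<open>In the expanded square of the centred sum, the off-diagonal terms are covariances and
  vanish by independence. Integrability of the square follows from that of all pairwise
  products.\<close>

lemma (in prob_space) variance_sum_indep:
  fixes X :: "'i \<Rightarrow> 'a \<Rightarrow> real"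
  assumes "finite I" and indep: "indep_vars (\<lambda>_. borel) X I"
    and sq: "\<And>i. i \<in> I \<Longrightarrow> integrable M (\<lambda>\<omega>. (X i \<omega>)\<^sup>2)"
  shows "variance (\<lambda>\<omega>. \<Sum>i\<in>I. X i \<omega>) = (\<Sum>i\<in>I. variance (X i))"
    and "integrable M (\<lambda>\<omega>. (\<Sum>i\<in>I. X i \<omega>)\<^sup>2)"
proof -
  have rv: "random_variable borel (X i)" if "i \<in> I" for i
    using indep that by (simp add: indep_vars_def)
  have int: "integrable M (X i)" if "i \<in> I" for i
    using square_integrable_imp_integrable[OF rv sq] that by blast
  have prod: "integrable M (\<lambda>\<omega>. X i \<omega> * X j \<omega>) \<and>
      (i \<noteq> j \<longrightarrow> expectation (\<lambda>\<omega>. X i \<omega> * X j \<omega>) = expectation (X i) * expectation (X j))"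
    if ij: "i \<in> I" "j \<in> I" for i j
  proof (cases "i = j")
    case True
    thus ?thesis using sq[of i] ij by (simp add: power2_eq_square)
  next
    case False
    have 1: "indep_vars (\<lambda>_. borel) X {i, j}"
      using ij by (intro indep_vars_subset[OF indep]) auto
    show ?thesis
      using indep_vars_integrable[OF _ 1] indep_vars_lebesgue_integral[OF _ 1] int ij False by auto
  qed
  define Y where "Y i \<omega> = X i \<omega> - expectation (X i)" for i \<omega>
  have Yexp: "(\<lambda>\<omega>. Y i \<omega> * Y j \<omega>) = (\<lambda>\<omega>. X i \<omega> * X j \<omega> - expectation (X j) * X i \<omega>
      - expectation (X i) * X j \<omega> + expectation (X i) * expectation (X j))" for i j
    by (auto simp: Y_def algebra_simps)
  have Yint: "integrable M (\<lambda>\<omega>. Y i \<omega> * Y j \<omega>)" if "i \<in> I" "j \<in> I" for i j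
    unfolding Yexp using prod int that by auto
  have Ycov: "expectation (\<lambda>\<omega>. Y i \<omega> * Y j \<omega>) = (if i = j then variance (X i) else 0)"
    if "i \<in> I" "j \<in> I" for i j
  proof (cases "i = j")
    case False
    thus ?thesis unfolding Yexp using prod[OF that] int that by (simp add: prob_space)
  qed (simp add: Y_def power2_eq_square)
  have "variance (\<lambda>\<omega>. \<Sum>i\<in>I. X i \<omega>) = expectation (\<lambda>\<omega>. \<Sum>i\<in>I. \<Sum>j\<in>I. Y i \<omega> * Y j \<omega>)"
  proof -
    have "(\<Sum>i\<in>I. X i \<omega>) - expectation (\<lambda>\<omega>. \<Sum>i\<in>I. X i \<omega>) = (\<Sum>i\<in>I. Y i \<omega>)" for \<omega>
      using int by (simp add: Y_def sum_subtractf)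
    thus ?thesis by (simp add: power2_eq_square sum_product)
  qed
  also have "\<dots> = (\<Sum>i\<in>I. \<Sum>j\<in>I. expectation (\<lambda>\<omega>. Y i \<omega> * Y j \<omega>))"
    using Yint by (subst Bochner_Integration.integral_sum) (auto intro!: sum.cong)
  also have "\<dots> = (\<Sum>i\<in>I. \<Sum>j\<in>I. if i = j then variance (X i) else 0)"
    using Ycov by (intro sum.cong) auto
  also have "\<dots> = (\<Sum>i\<in>I. variance (X i))" using \<open>finite I\<close> by simp
  finally show "variance (\<lambda>\<omega>. \<Sum>i\<in>I. X i \<omega>) = (\<Sum>i\<in>I. variance (X i))" .
  show "integrable M (\<lambda>\<omega>. (\<Sum>i\<in>I. X i \<omega>)\<^sup>2)"
    unfolding power2_eq_square sum_product using prod by auto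
qed

lemma continuous_blinfun: "continuous_on UNIV (blinfun_apply \<phi>)"
  by (intro continuous_intros)

section \<open>Means and variances of functionals of increments\<close>

context levy_process
begin

lemma levy_measurable:
  assumes "0 \<le> s" "0 \<le> t" "continuous_on UNIV g"
  shows "(\<lambda>\<omega>. g (L t \<omega> - L s \<omega>)) \<in> borel_measurable M"
proof -
  have [measurable]: "g \<in> borel_measurable borel"
    using assms(3) by (simp add: borel_measurable_continuous_onI)
  show ?thesis using random_variable_levy[OF assms(1)] random_variable_levy[OF assms(2)] by measurable
qed

text \<open>Stationarity equates the image measures of \<open>L t - L s\<close> and
  \<open>L (t - s)\<close>; both claims are changes of variables along these measures, with
  continuity of \<open>g\<close> supplying Borel measurability.\<close>

lemma expectation_increment:
  fixes g :: "'a \<Rightarrow> real"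
  assumes st: "0 \<le> s" "s \<le> t" and g: "continuous_on UNIV g"
  shows "expectation (\<lambda>\<omega>. g (L t \<omega> - L s \<omega>)) = expectation (\<lambda>\<omega>. g (L (t - s) \<omega>))"
    and "integrable M (\<lambda>\<omega>. g (L t \<omega> - L s \<omega>)) \<longleftrightarrow> integrable M (\<lambda>\<omega>. g (L (t - s) \<omega>))"
proof -
  have gb: "g \<in> borel_measurable borel"
    using g by (simp add: borel_measurable_continuous_onI)
  have d: "(\<lambda>\<omega>. L t \<omega> - L s \<omega>) \<in> borel_measurable M" "L (t - s) \<in> borel_measurable M"
    using st by (auto intro!: borel_measurable_diff random_variable_levy)
  show "expectation (\<lambda>\<omega>. g (L t \<omega> - L s \<omega>)) = expectation (\<lambda>\<omega>. g (L (t - s) \<omega>))"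
    using stationary_increments[OF st] integral_distr[OF d(1) gb] integral_distr[OF d(2) gb] by simp
  show "integrable M (\<lambda>\<omega>. g (L t \<omega> - L s \<omega>)) \<longleftrightarrow> integrable M (\<lambda>\<omega>. g (L (t - s) \<omega>))"
    using stationary_increments[OF st] integrable_distr_eq[OF d(1) gb] integrable_distr_eq[OF d(2) gb]
    by simp
qed

lemma integrable_functional_sq:
  fixes \<phi> :: "'a \<Rightarrow>\<^sub>L real"
  assumes sq: "square_integrable_process M L" and "0 \<le> t"
  shows "integrable M (\<lambda>\<omega>. (\<phi> (L t \<omega>))\<^sup>2)" "integrable M (\<lambda>\<omega>. \<phi> (L t \<omega>))"
    and "expectation (\<lambda>\<omega>. (\<phi> (L t \<omega>))\<^sup>2) \<le> (norm \<phi>)\<^sup>2 * expectation (\<lambda>\<omega>. (norm (L t \<omega>))\<^sup>2)"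
proof -
  have L: "integrable M (\<lambda>\<omega>. (norm (L t \<omega>))\<^sup>2)"
    using sq \<open>0 \<le> t\<close> by (auto simp: square_integrable_process_def)
  have Lm[measurable]: "L t \<in> borel_measurable M" by (rule random_variable_levy[OF \<open>0 \<le> t\<close>])
  have [measurable]: "blinfun_apply \<phi> \<in> borel_measurable borel"
    by (intro borel_measurable_continuous_onI continuous_intros)
  have le: "(\<phi> (L t \<omega>))\<^sup>2 \<le> (norm \<phi>)\<^sup>2 * (norm (L t \<omega>))\<^sup>2" for \<omega>
    using power_mono[OF norm_blinfun[of \<phi> "L t \<omega>"], of 2] by (simp add: power_mult_distrib)
  have int: "integrable M (\<lambda>\<omega>. (norm \<phi>)\<^sup>2 * (norm (L t \<omega>))\<^sup>2)" using L by simp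
  show 1: "integrable M (\<lambda>\<omega>. (\<phi> (L t \<omega>))\<^sup>2)"
    by (rule Bochner_Integration.integrable_bound[OF int]) (use le in auto)
  show "integrable M (\<lambda>\<omega>. \<phi> (L t \<omega>))"
    by (rule square_integrable_imp_integrable[OF _ 1]) measurable
  show "expectation (\<lambda>\<omega>. (\<phi> (L t \<omega>))\<^sup>2) \<le> (norm \<phi>)\<^sup>2 * expectation (\<lambda>\<omega>. (norm (L t \<omega>))\<^sup>2)"
    using integral_mono[OF 1 int le] by simp
qed

lemma variance_functional_increment:
  fixes \<phi> :: "'a \<Rightarrow>\<^sub>L real"
  assumes "0 \<le> s" "s \<le> t"
  shows "variance (\<lambda>\<omega>. \<phi> (L t \<omega> - L s \<omega>)) = variance (\<lambda>\<omega>. \<phi> (L (t - s) \<omega>))"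
  unfolding expectation_increment(1)[OF assms continuous_blinfun]
  by (rule expectation_increment(1)[OF assms]) (intro continuous_intros)

lemma expectation_functional_add:
  fixes \<phi> :: "'a \<Rightarrow>\<^sub>L real"
  assumes sq: "square_integrable_process M L" and "0 \<le> s" "0 \<le> t"
  shows "expectation (\<lambda>\<omega>. \<phi> (L (s + t) \<omega>)) = expectation (\<lambda>\<omega>. \<phi> (L s \<omega>)) + expectation (\<lambda>\<omega>. \<phi> (L t \<omega>))"
proof -
  have "expectation (\<lambda>\<omega>. \<phi> (L t \<omega>)) = expectation (\<lambda>\<omega>. \<phi> (L (s + t) \<omega> - L s \<omega>))"
    using expectation_increment(1)[OF \<open>0 \<le> s\<close> _ continuous_blinfun, of "s + t" \<phi>] assms by simp
  also have "\<dots> = expectation (\<lambda>\<omega>. \<phi> (L (s + t) \<omega>)) - expectation (\<lambda>\<omega>. \<phi> (L s \<omega>))"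
    using integrable_functional_sq(2)[OF sq] assms by (simp add: blinfun.diff_right)
  finally show ?thesis by simp
qed

text \<open>\<open>L (s + t)\<close> is built from independent increments over \<open>[0, s]\<close>
  and \<open>[s, s + t]\<close>, so the variance is additive in time; being non-negative, it is
  linear.\<close>

lemma variance_functional:
  fixes \<phi> :: "'a \<Rightarrow>\<^sub>L real"
  assumes sq: "square_integrable_process M L" and "0 \<le> t"
  shows "variance (\<lambda>\<omega>. \<phi> (L t \<omega>)) = t * variance (\<lambda>\<omega>. \<phi> (L 1 \<omega>))"
proof (rule additive_nonneg_imp_linear[OF _ variance_positive \<open>0 \<le> t\<close>])
  fix s t :: real assume st: "0 \<le> s" "0 \<le> t"
  \<comment> \<open>The points 0, \<open>s\<close>, \<open>s + t\<close>, continued constantly so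
    that monotonicity holds at every index.\<close>
  define \<tau> where "\<tau> i = (if i = 0 then 0 else if i = 1 then s else s + t)" for i :: nat
  define X where "X i \<omega> = \<phi> (L (\<tau> (Suc i)) \<omega> - L (\<tau> i) \<omega>)" for i \<omega>
  have \<tau>: "0 \<le> \<tau> i" "\<tau> i \<le> \<tau> (Suc i)" for i using st by (auto simp: \<tau>_def)
  have indep: "indep_vars (\<lambda>_. borel) X {..<2}"
    unfolding X_def
    by (rule indep_vars_compose2[OF independent_increments])
      (auto intro!: \<tau> borel_measurable_continuous_onI continuous_intros)
  have Xsq: "integrable M (\<lambda>\<omega>. (X i \<omega>)\<^sup>2)" for i
    unfolding X_def
    by (subst expectation_increment(2)[OF \<tau>, where g="\<lambda>x. (\<phi> x)\<^sup>2"])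
      (auto intro!: continuous_intros integrable_functional_sq[OF sq] \<tau>)
  have "variance (\<lambda>\<omega>. \<Sum>i<2. X i \<omega>) = (\<Sum>i<2. variance (X i))"
    by (rule variance_sum_indep[OF _ indep Xsq]) simp
  also have "\<dots> = (\<Sum>i<2. variance (\<lambda>\<omega>. \<phi> (L (\<tau> (Suc i) - \<tau> i) \<omega>)))"
    unfolding X_def by (intro sum.cong variance_functional_increment \<tau> refl)
  also have "\<dots> = variance (\<lambda>\<omega>. \<phi> (L s \<omega>)) + variance (\<lambda>\<omega>. \<phi> (L t \<omega>))"
    by (simp add: \<tau>_def numeral_2_eq_2)
  also have "variance (\<lambda>\<omega>. \<Sum>i<2. X i \<omega>) = variance (\<lambda>\<omega>. \<phi> (L (s + t) \<omega> - L 0 \<omega>))"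
    by (simp add: X_def \<tau>_def numeral_2_eq_2 blinfun.diff_right)
  \<comment> \<open>\<open>L 0\<close> vanishes only almost surely; stationarity on the interval
    from 0 to \<open>s + t\<close> removes it from the variance.\<close>
  also have "\<dots> = variance (\<lambda>\<omega>. \<phi> (L (s + t) \<omega>))"
    using variance_functional_increment[of 0 "s + t" \<phi>] st by simp
  finally show "variance (\<lambda>\<omega>. \<phi> (L (s + t) \<omega>)) = variance (\<lambda>\<omega>. \<phi> (L s \<omega>)) + variance (\<lambda>\<omega>. \<phi> (L t \<omega>))" .
qed

text \<open>The increments are not centred: \<open>K\<close> collects a variance part and, by Cauchy-Schwarz, a mean part.\<close>

lemma second_moment_functional_sum:
  fixes \<phi> :: "nat \<Rightarrow> 'a \<Rightarrow>\<^sub>L real"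
  assumes sq: "square_integrable_process M L"
    and c: "0 \<le> c" "\<And>\<psi> t. 0 \<le> t \<Longrightarrow> \<bar>expectation (\<lambda>\<omega>. blinfun_apply \<psi> (L t \<omega>))\<bar> \<le> c * norm \<psi> * t"
    and part: "partition_of t n \<tau>"
  defines "K \<equiv> expectation (\<lambda>\<omega>. (norm (L 1 \<omega>))\<^sup>2) + c\<^sup>2 * t"
  shows "expectation (\<lambda>\<omega>. (\<Sum>i<n. \<phi> i (L (\<tau> (Suc i)) \<omega> - L (\<tau> i) \<omega>))\<^sup>2)
      \<le> K * (\<Sum>i<n. (norm (\<phi> i))\<^sup>2 * (\<tau> (Suc i) - \<tau> i))"
    and "integrable M (\<lambda>\<omega>. (\<Sum>i<n. \<phi> i (L (\<tau> (Suc i)) \<omega> - L (\<tau> i) \<omega>))\<^sup>2)"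
proof -
  define X where "X i \<omega> = \<phi> i (L (\<tau> (Suc i)) \<omega> - L (\<tau> i) \<omega>)" for i \<omega>
  define \<delta> where "\<delta> i = \<tau> (Suc i) - \<tau> i" for i
  define S where "S = (\<Sum>i<n. (norm (\<phi> i))\<^sup>2 * \<delta> i)"
  have mono: "\<tau> i \<le> \<tau> (Suc i)" if "i < n" for i using part that by (auto simp: partition_of_def)
  have \<tau>0: "0 \<le> \<tau> i" if "i \<le> n" for i
    using that
  proof (induction i)
    case 0 thus ?case using part by (auto simp: partition_of_def)
  next
    case (Suc i) thus ?case using mono[of i] by simp
  qed
  have \<tau>: "0 \<le> \<tau> i" "\<tau> i \<le> \<tau> (Suc i)" if "i < n" for i using mono \<tau>0 that by auto
  have \<delta>: "0 \<le> \<delta> i" if "i < n" for i using mono that by (simp add: \<delta>_def)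
  have indep: "indep_vars (\<lambda>_. borel) X {..<n}"
    unfolding X_def
    by (rule indep_vars_compose2[OF independent_increments])
      (auto intro!: \<tau>0 mono borel_measurable_continuous_onI continuous_intros)
  have Xsq: "integrable M (\<lambda>\<omega>. (X i \<omega>)\<^sup>2)" if "i \<in> {..<n}" for i
    unfolding X_def
    using that
    by (subst expectation_increment(2)[OF \<tau>, where g="\<lambda>x. (\<phi> i x)\<^sup>2"])
      (auto intro!: continuous_intros integrable_functional_sq[OF sq] simp: mono)
  have Xm: "X i \<in> borel_measurable M" if "i < n" for i
    using indep that by (auto simp: indep_vars_def)
  have Xint: "integrable M (X i)" if "i < n" for i
    using square_integrable_imp_integrable[OF Xm Xsq] that by simp
  have sumsq: "integrable M (\<lambda>\<omega>. (\<Sum>i<n. X i \<omega>)\<^sup>2)"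
    by (rule variance_sum_indep(2)[OF _ indep Xsq]) auto
  thus "integrable M (\<lambda>\<omega>. (\<Sum>i<n. \<phi> i (L (\<tau> (Suc i)) \<omega> - L (\<tau> i) \<omega>))\<^sup>2)"
    by (simp add: X_def)
  have E: "\<bar>expectation (X i)\<bar> \<le> c * norm (\<phi> i) * \<delta> i" if "i < n" for i
  proof -
    have "expectation (X i) = expectation (\<lambda>\<omega>. \<phi> i (L (\<delta> i) \<omega>))"
      unfolding X_def \<delta>_def by (rule expectation_increment(1)[OF \<tau>[OF that] continuous_blinfun])
    thus ?thesis using c(2)[OF \<delta>[OF that]] by simp
  qed
  have V: "variance (X i) \<le> expectation (\<lambda>\<omega>. (norm (L 1 \<omega>))\<^sup>2) * ((norm (\<phi> i))\<^sup>2 * \<delta> i)" if "i < n" for i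
  proof -
    have "variance (X i) = variance (\<lambda>\<omega>. \<phi> i (L (\<delta> i) \<omega>))"
      unfolding X_def \<delta>_def by (rule variance_functional_increment[OF \<tau>[OF that]])
    \<comment> \<open>Linearity in time extracts the interval length; what remains is a variance at
      time 1, bounded by the second moment there.\<close>
    also have "\<dots> = \<delta> i * variance (\<lambda>\<omega>. \<phi> i (L 1 \<omega>))" by (rule variance_functional[OF sq \<delta>[OF that]])
    also have "\<dots> \<le> \<delta> i * ((norm (\<phi> i))\<^sup>2 * expectation (\<lambda>\<omega>. (norm (L 1 \<omega>))\<^sup>2))"
    proof (rule mult_left_mono[OF _ \<delta>[OF that]])
      have "variance (\<lambda>\<omega>. \<phi> i (L 1 \<omega>)) \<le> expectation (\<lambda>\<omega>. (\<phi> i (L 1 \<omega>))\<^sup>2)"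
        by (subst variance_eq) (auto intro: integrable_functional_sq[OF sq])
      also have "\<dots> \<le> (norm (\<phi> i))\<^sup>2 * expectation (\<lambda>\<omega>. (norm (L 1 \<omega>))\<^sup>2)"
        by (rule integrable_functional_sq(3)[OF sq]) simp
      finally show "variance (\<lambda>\<omega>. \<phi> i (L 1 \<omega>)) \<le> \<dots>" .
    qed
    finally show ?thesis by (simp only: mult_ac)
  qed
  have len: "(\<Sum>i<n. \<delta> i) \<le> t"
    using part sum_lessThan_telescope[of \<tau> n] by (auto simp: \<delta>_def partition_of_def)
  have "\<bar>\<Sum>i<n. expectation (X i)\<bar> \<le> (\<Sum>i<n. c * norm (\<phi> i) * \<delta> i)"
    by (rule order_trans[OF sum_abs]) (auto intro!: sum_mono E)
  \<comment> \<open>Each weight \<open>\<delta> i\<close> is split into two square roots, so that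
    Cauchy-Schwarz yields \<open>sqrt S\<close> times the root of the total length, which is at most
    \<open>sqrt t\<close>.\<close>
  also have "\<dots> = c * (\<Sum>i<n. \<bar>norm (\<phi> i) * sqrt (\<delta> i)\<bar> * \<bar>sqrt (\<delta> i)\<bar>)"
    unfolding sum_distrib_left by (intro sum.cong refl) (simp add: \<delta> abs_mult)
  also have "\<dots> \<le> c * (L2_set (\<lambda>i. norm (\<phi> i) * sqrt (\<delta> i)) {..<n} * L2_set (\<lambda>i. sqrt (\<delta> i)) {..<n})"
    by (intro mult_left_mono L2_set_mult_ineq c)
  also have "L2_set (\<lambda>i. norm (\<phi> i) * sqrt (\<delta> i)) {..<n} = sqrt S"
    unfolding L2_set_def S_def by (intro arg_cong[where f=sqrt] sum.cong) (auto simp: power_mult_distrib \<delta>)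
  also have "L2_set (\<lambda>i. sqrt (\<delta> i)) {..<n} = sqrt (\<Sum>i<n. \<delta> i)"
    unfolding L2_set_def by (intro arg_cong[where f=sqrt] sum.cong) (auto simp: \<delta>)
  finally have mean: "\<bar>\<Sum>i<n. expectation (X i)\<bar> \<le> c * (sqrt S * sqrt (\<Sum>i<n. \<delta> i))" .
  have S: "0 \<le> S" unfolding S_def by (auto intro!: sum_nonneg mult_nonneg_nonneg \<delta>)
  have "(\<Sum>i<n. expectation (X i))\<^sup>2 \<le> (c * (sqrt S * sqrt (\<Sum>i<n. \<delta> i)))\<^sup>2"
    using power_mono[OF mean, of 2] by simp
  also have "\<dots> = c\<^sup>2 * S * (\<Sum>i<n. \<delta> i)"
    using S sum_nonneg[of "{..<n}" \<delta>] \<delta> by (simp add: power_mult_distrib)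
  also have "\<dots> \<le> c\<^sup>2 * S * t" using S by (intro mult_left_mono len) auto
  finally have mean2: "(\<Sum>i<n. expectation (X i))\<^sup>2 \<le> c\<^sup>2 * S * t" .
  \<comment> \<open>The second moment is variance plus squared mean: the first contributes the
    moment of \<open>L 1\<close> to \<open>K\<close>, the second
    \<open>c\<^sup>2 * t\<close>.\<close>
  have "expectation (\<lambda>\<omega>. (\<Sum>i<n. X i \<omega>)\<^sup>2)
      = variance (\<lambda>\<omega>. \<Sum>i<n. X i \<omega>) + (expectation (\<lambda>\<omega>. \<Sum>i<n. X i \<omega>))\<^sup>2"
    using Xint sumsq by (subst variance_eq) auto
  also have "variance (\<lambda>\<omega>. \<Sum>i<n. X i \<omega>) = (\<Sum>i<n. variance (X i))"
    by (rule variance_sum_indep[OF _ indep Xsq]) auto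
  also have "\<dots> \<le> expectation (\<lambda>\<omega>. (norm (L 1 \<omega>))\<^sup>2) * S"
    unfolding S_def sum_distrib_left by (intro sum_mono V) auto
  also have "(expectation (\<lambda>\<omega>. \<Sum>i<n. X i \<omega>))\<^sup>2 = (\<Sum>i<n. expectation (X i))\<^sup>2"
    using Xint by simp
  also note mean2
  finally show "expectation (\<lambda>\<omega>. (\<Sum>i<n. \<phi> i (L (\<tau> (Suc i)) \<omega> - L (\<tau> i) \<omega>))\<^sup>2)
      \<le> K * (\<Sum>i<n. (norm (\<phi> i))\<^sup>2 * (\<tau> (Suc i) - \<tau> i))"
    unfolding K_def S_def X_def \<delta>_def by (simp add: algebra_simps)
qed

end


section \<open>Step approximations of stochastic integrals\<close>

lemma partition_of_mono:
  assumes "partition_of t n \<tau>" "i \<le> j" "j \<le> n"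
  shows "\<tau> i \<le> \<tau> j"
  using assms(2,3)
proof (induction j rule: dec_induct)
  case (step j)
  hence "\<tau> j \<le> \<tau> (Suc j)" using assms(1) by (simp add: partition_of_def)
  thus ?case using step by simp
qed simp

lemma partition_of_bounds:
  assumes "partition_of t n \<tau>" "i \<le> n"
  shows "0 \<le> \<tau> i" "\<tau> i \<le> t"
  using assms partition_of_mono[OF assms(1), of 0 i] partition_of_mono[OF assms(1), of i n]
  by (auto simp: partition_of_def)

lemma partition_of_disjoint:
  assumes "partition_of t n \<tau>" "i < n" "j < n" "s \<in> {\<tau> i<..\<tau> (Suc i)}" "s \<in> {\<tau> j<..\<tau> (Suc j)}"
  shows "i = j"
proof (rule linorder_cases[of i j])
  assume "i < j"
  thus ?thesis using partition_of_mono[OF assms(1), of "Suc i" j] assms(3-5) by simp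
next
  assume "j < i"
  thus ?thesis using partition_of_mono[OF assms(1), of "Suc j" i] assms(2,4,5) by simp
qed

lemma step_function_on_interval:
  assumes "partition_of t n \<tau>" "i < n" "s \<in> {\<tau> i<..\<tau> (Suc i)}"
  shows "step_function n \<tau> A s = A i"
proof -
  have "step_function n \<tau> A s = (\<Sum>j<n. if j = i then A i else 0)"
    unfolding step_function_def
  proof (intro sum.cong refl)
    fix j assume j: "j \<in> {..<n}"
    show "indicator {\<tau> j<..\<tau> (Suc j)} s *\<^sub>R A j = (if j = i then A i else 0)"
    proof (cases "s \<in> {\<tau> j<..\<tau> (Suc j)}")
      case True
      have "j = i" using partition_of_disjoint[OF assms(1) _ assms(2) True assms(3)] j by blast
      thus ?thesis using assms(3) by simp
    next
      case False
      hence "j \<noteq> i" using assms(3) by blast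
      thus ?thesis using False by simp
    qed
  qed
  thus ?thesis using assms(2) by simp
qed

section \<open>Selecting values of the integrand\<close>

text \<open>Were all values too large, \<open>g\<close> would dominate on the interval a constant
  exceeding its average by \<epsilon>, and integrating that constant would give more than the
  integral of \<open>g\<close>. The slack \<epsilon> makes this contradiction strict. Comparing with
  a constant works for a lower integral as well.\<close>

lemma exists_point_le_average:
  fixes g :: "real \<Rightarrow> real"
  assumes "a \<le> b" "0 < \<epsilon>" and g: "\<And>s. 0 \<le> g s"
  shows "\<exists>s\<in>{a..b}. ennreal (g s * (b - a)) \<le> (\<integral>\<^sup>+s\<in>{a<..b}. ennreal (g s) \<partial>lborel) + ennreal (\<epsilon> * (b - a))"
proof (cases "a = b")
  case True
  \<comment> \<open>For \<open>a = b\<close> the half-open interval is empty, so the point is sought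
    in the closed one; both sides are then 0.\<close>
  thus ?thesis by (intro bexI[of _ a]) auto
next
  case False
  hence ab: "a < b" using assms by simp
  define J where "J = (\<integral>\<^sup>+s\<in>{a<..b}. ennreal (g s) \<partial>lborel)"
  show ?thesis
  proof (rule ccontr)
    assume "\<not> ?thesis"
    hence "\<not> ennreal (g s * (b - a)) \<le> J + ennreal (\<epsilon> * (b - a))" if "s \<in> {a..b}" for s
      using that unfolding J_def by blast
    hence gt: "J + ennreal (\<epsilon> * (b - a)) < ennreal (g s * (b - a))" if "s \<in> {a<..b}" for s
      using that by (simp add: not_le)
    \<comment> \<open>A quantity strictly below a finite number is finite, so the integral can be
      treated as a real \<open>r\<close>.\<close>
    from gt[of b] ab have "J \<noteq> \<top>" by auto
    then obtain r where r: "0 \<le> r" "J = ennreal r" by (cases J) auto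
    define q where "q = r / (b - a) + \<epsilon>"
    have q: "0 \<le> q" using r ab \<open>0 < \<epsilon>\<close> by (simp add: q_def)
    have le: "q \<le> g s" if "s \<in> {a<..b}" for s
    proof -
      have "ennreal (r + \<epsilon> * (b - a)) < ennreal (g s * (b - a))"
        using gt[OF that] r ab \<open>0 < \<epsilon>\<close> by (simp add: ennreal_plus)
      hence "r + \<epsilon> * (b - a) < g s * (b - a)"
        using r ab \<open>0 < \<epsilon>\<close> by (subst (asm) ennreal_less_iff) auto
      thus ?thesis using ab by (simp add: q_def field_simps)
    qed
    have "r + \<epsilon> * (b - a) = q * (b - a)" using ab by (simp add: q_def distrib_right)
    hence "ennreal (r + \<epsilon> * (b - a)) = ennreal q * ennreal (b - a)"
      using q ab by (simp add: ennreal_mult)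
    also have "\<dots> = (\<integral>\<^sup>+s\<in>{a<..b}. ennreal q \<partial>lborel)"
      using ab by (simp add: nn_integral_cmult_indicator)
    also have "\<dots> \<le> J"
      unfolding J_def using le by (intro nn_integral_mono) (auto simp: indicator_def intro: ennreal_leI)
    finally show False using r ab \<open>0 < \<epsilon>\<close> by (simp add: mult_le_0_iff)
  qed
qed

text \<open>An arbitrary approximating step function is replaced by one whose values are values of
  the integrand itself, without refining the partition.\<close>

lemma step_function_value_selection:
  fixes \<Phi> :: "real \<Rightarrow> 'a::real_normed_vector \<Rightarrow>\<^sub>L 'b::real_normed_vector"
  assumes part: "partition_of t n \<tau>" and "0 < \<epsilon>"
    and meas: "\<Phi> \<in> borel_measurable (restrict_space lborel {0..t})"
  obtains \<sigma> where "\<And>i. i < n \<Longrightarrow> \<sigma> i \<in> {0..t}"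
    and "ennreal (\<Sum>i<n. (norm (\<Phi> (\<sigma> i) - A i))\<^sup>2 * (\<tau> (Suc i) - \<tau> i))
      \<le> (\<integral>\<^sup>+s\<in>{0..t}. ennreal ((norm (\<Phi> s - step_function n \<tau> A s))\<^sup>2) \<partial>lborel) + ennreal (\<epsilon> * t)"
proof -
  define I where "I i = {\<tau> i<..\<tau> (Suc i)}" for i
  define g where "g i s = (norm (\<Phi> s - A i))\<^sup>2" for i s
  define \<delta> where "\<delta> i = \<tau> (Suc i) - \<tau> i" for i
  have b: "0 \<le> \<tau> i" "\<tau> i \<le> \<tau> (Suc i)" "\<tau> (Suc i) \<le> t" if "i < n" for i
    using partition_of_bounds[OF part] part that by (auto simp: partition_of_def)
  have "\<exists>s\<in>{\<tau> i..\<tau> (Suc i)}. ennreal (g i s * \<delta> i) \<le> (\<integral>\<^sup>+s\<in>I i. ennreal (g i s) \<partial>lborel) + ennreal (\<epsilon> * \<delta> i)"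
    if "i < n" for i
    unfolding \<delta>_def I_def by (rule exists_point_le_average[OF b(2)[OF that] \<open>0 < \<epsilon>\<close>]) (simp add: g_def)
  then obtain \<sigma> where \<sigma>: "\<And>i. i < n \<Longrightarrow> \<sigma> i \<in> {\<tau> i..\<tau> (Suc i)}"
      "\<And>i. i < n \<Longrightarrow> ennreal (g i (\<sigma> i) * \<delta> i) \<le> (\<integral>\<^sup>+s\<in>I i. ennreal (g i s) \<partial>lborel) + ennreal (\<epsilon> * \<delta> i)"
    by metis
  have \<delta>: "0 \<le> \<delta> i" if "i < n" for i using b that by (simp add: \<delta>_def)
  have sum\<delta>: "(\<Sum>i<n. \<delta> i) \<le> t"
    using part sum_lessThan_telescope[of \<tau> n] by (auto simp: \<delta>_def partition_of_def)
  \<comment> \<open>\<Phi> is measurable only on \<open>{0..t}\<close>. Extending by 0 and cutting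
    down to \<open>I i\<close> gives global measurability, which the exchange of sum and integral
    below requires.\<close>
  have gm: "(\<lambda>s. ennreal (g i s) * indicator (I i) s) \<in> borel_measurable lborel" if "i < n" for i
  proof -
    have [measurable]: "(\<lambda>x. (norm (x - A i))\<^sup>2) \<in> borel_measurable borel"
      by (intro borel_measurable_continuous_onI continuous_intros)
    have "(\<lambda>s. ennreal (g i s)) \<in> borel_measurable (restrict_space lborel {0..t})"
      unfolding g_def using meas by measurable
    hence [measurable]: "(\<lambda>s. ennreal (g i s) * indicator {0..t} s) \<in> borel_measurable lborel"
      by (subst (asm) borel_measurable_restrict_space_iff_ennreal) auto
    have "(\<lambda>s. ennreal (g i s) * indicator (I i) s) = (\<lambda>s. ennreal (g i s) * indicator {0..t} s * indicator (I i) s)"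
      using b[OF that] by (auto simp: indicator_def I_def fun_eq_iff)
    also have "\<dots> \<in> borel_measurable lborel" unfolding I_def by measurable
    finally show ?thesis .
  qed
  have "ennreal (\<Sum>i<n. g i (\<sigma> i) * \<delta> i) = (\<Sum>i<n. ennreal (g i (\<sigma> i) * \<delta> i))"
    using \<delta> by (intro sum_ennreal[symmetric]) (auto simp: g_def)
  also have "\<dots> \<le> (\<Sum>i<n. (\<integral>\<^sup>+s\<in>I i. ennreal (g i s) \<partial>lborel) + ennreal (\<epsilon> * \<delta> i))"
    by (intro sum_mono \<sigma>) auto
  also have "\<dots> = (\<Sum>i<n. \<integral>\<^sup>+s\<in>I i. ennreal (g i s) \<partial>lborel) + (\<Sum>i<n. ennreal (\<epsilon> * \<delta> i))"
    by (rule sum.distrib)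
  also have "(\<Sum>i<n. ennreal (\<epsilon> * \<delta> i)) = ennreal (\<epsilon> * (\<Sum>i<n. \<delta> i))"
    unfolding sum_distrib_left using \<delta> \<open>0 < \<epsilon>\<close> by (intro sum_ennreal) auto
  also have "\<dots> \<le> ennreal (\<epsilon> * t)"
    using sum\<delta> \<open>0 < \<epsilon>\<close> by (intro ennreal_leI) simp
  also have "(\<Sum>i<n. \<integral>\<^sup>+s\<in>I i. ennreal (g i s) \<partial>lborel) = (\<integral>\<^sup>+s. (\<Sum>i<n. ennreal (g i s) * indicator (I i) s) \<partial>lborel)"
    using gm by (intro nn_integral_sum[symmetric]) auto
  also have "\<dots> \<le> (\<integral>\<^sup>+s\<in>{0..t}. ennreal ((norm (\<Phi> s - step_function n \<tau> A s))\<^sup>2) \<partial>lborel)"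
  proof (intro nn_integral_mono)
    fix s
    show "(\<Sum>i<n. ennreal (g i s) * indicator (I i) s)
        \<le> ennreal ((norm (\<Phi> s - step_function n \<tau> A s))\<^sup>2) * indicator {0..t} s"
    \<comment> \<open>At most one interval contains \<open>s\<close>, and there the step function
      takes the value \<open>A k\<close>; off all intervals the left-hand side is 0.\<close>
    proof (cases "\<exists>k<n. s \<in> I k")
      case True
      then obtain k where k: "k < n" "s \<in> I k" by blast
      have "(\<Sum>i<n. ennreal (g i s) * indicator (I i) s) = (\<Sum>i<n. if i = k then ennreal (g k s) else 0)"
      proof (intro sum.cong refl)
        fix i assume "i \<in> {..<n}"
        hence "s \<in> I i \<longleftrightarrow> i = k"
          using partition_of_disjoint[OF part _ k(1) _ k(2)[unfolded I_def]] k unfolding I_def by blast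
        thus "ennreal (g i s) * indicator (I i) s = (if i = k then ennreal (g k s) else 0)"
          by (simp add: indicator_def)
      qed
      also have "\<dots> = ennreal ((norm (\<Phi> s - step_function n \<tau> A s))\<^sup>2)"
        using k step_function_on_interval[OF part k(1) k(2)[unfolded I_def], of A] by (simp add: g_def)
      finally show ?thesis using k b[OF k(1)] by (simp add: I_def)
    qed (auto simp: indicator_def intro!: sum.neutral)
  qed
  finally have "ennreal (\<Sum>i<n. g i (\<sigma> i) * \<delta> i)
      \<le> (\<integral>\<^sup>+s\<in>{0..t}. ennreal ((norm (\<Phi> s - step_function n \<tau> A s))\<^sup>2) \<partial>lborel) + ennreal (\<epsilon> * t)"
    by (simp add: add_right_mono add_left_mono)
  moreover have "\<sigma> i \<in> {0..t}" if "i < n" for i using \<sigma>(1)[OF that] b[OF that] by auto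
  ultimately show thesis using that unfolding g_def \<delta>_def by blast
qed

section \<open>Positivity of functionals of the stochastic integral\<close>

text \<open>Testing with \<psi> reduces the estimate to real random variables, where
  \<open>second_moment_functional_sum\<close> applies. The negative part of
  \<open>\<psi> (Z \<omega>)\<close> is no larger than its distance to any non-negative number, and
  such numbers approximate it in mean square.\<close>

lemma (in levy_process) has_stochastic_integral_functional_nonneg:
  fixes \<Phi> :: "real \<Rightarrow> 'a \<Rightarrow>\<^sub>L 'b::{real_normed_vector, second_countable_topology}"
    and \<psi> :: "'b \<Rightarrow>\<^sub>L real"
  assumes sq: "square_integrable_process M L"
    and c: "0 \<le> c" "\<And>\<phi> t. 0 \<le> t \<Longrightarrow> \<bar>expectation (\<lambda>\<omega>. blinfun_apply \<phi> (L t \<omega>))\<bar> \<le> c * norm \<phi> * t"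
    and t: "0 \<le> t" and Z: "has_stochastic_integral M L t \<Phi> Z"
    and pos: "\<And>s u v. s \<in> {0..t} \<Longrightarrow> 0 \<le> u \<Longrightarrow> u \<le> v \<Longrightarrow> AE \<omega> in M. 0 \<le> \<psi> (\<Phi> s (L v \<omega> - L u \<omega>))"
  shows "AE \<omega> in M. 0 \<le> \<psi> (Z \<omega>)"
proof -
  define K where "K = expectation (\<lambda>\<omega>. (norm (L 1 \<omega>))\<^sup>2) + c\<^sup>2 * t"
  \<comment> \<open>The squared negative part, whose integral is shown to vanish.\<close>
  define N where "N \<omega> = (max 0 (- \<psi> (Z \<omega>)))\<^sup>2" for \<omega>
  have K: "0 \<le> K" using t by (simp add: K_def)
  obtain n \<tau> A where part: "\<And>k. partition_of t (n k) (\<tau> k)"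
    and lim\<Phi>: "(\<lambda>k. \<integral>\<^sup>+s\<in>{0..t}. ennreal ((norm (\<Phi> s - step_function (n k) (\<tau> k) (A k) s))\<^sup>2) \<partial>lborel) \<longlonglongrightarrow> 0"
    and limZ: "(\<lambda>k. \<integral>\<^sup>+\<omega>. ennreal ((norm (step_integral L (n k) (\<tau> k) (A k) \<omega> - Z \<omega>))\<^sup>2) \<partial>M) \<longlonglongrightarrow> 0"
    and \<Phi>m: "\<Phi> \<in> borel_measurable (restrict_space lborel {0..t})" and Zm[measurable]: "Z \<in> borel_measurable M"
    using Z unfolding has_stochastic_integral_def by blast
  define J where "J k = (\<integral>\<^sup>+s\<in>{0..t}. ennreal ((norm (\<Phi> s - step_function (n k) (\<tau> k) (A k) s))\<^sup>2) \<partial>lborel)" for k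
  define E where "E k = (\<integral>\<^sup>+\<omega>. ennreal ((norm (step_integral L (n k) (\<tau> k) (A k) \<omega> - Z \<omega>))\<^sup>2) \<partial>M)" for k
  have bound: "(\<integral>\<^sup>+\<omega>. ennreal (N \<omega>) \<partial>M)
      \<le> ennreal (2 * (K * (norm \<psi>)\<^sup>2)) * (J k + ennreal (1 / real (Suc k) * t)) + ennreal (2 * (norm \<psi>)\<^sup>2) * E k" for k
  proof -
    obtain \<sigma> where \<sigma>: "\<And>i. i < n k \<Longrightarrow> \<sigma> i \<in> {0..t}"
      and \<sigma>_le: "ennreal (\<Sum>i<n k. (norm (\<Phi> (\<sigma> i) - A k i))\<^sup>2 * (\<tau> k (Suc i) - \<tau> k i))
        \<le> J k + ennreal (1 / real (Suc k) * t)"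
      \<comment> \<open>The slack \<open>1 / Suc k\<close> is chosen to disappear in the
        limit.\<close>
      using step_function_value_selection[OF part _ \<Phi>m, where \<epsilon>="1 / real (Suc k)" and A="A k"]
      unfolding J_def by auto
    define S where "S = step_integral L (n k) (\<tau> k) (A k)"
    define P where "P \<omega> = (\<Sum>i<n k. \<psi> (\<Phi> (\<sigma> i) (L (\<tau> k (Suc i)) \<omega> - L (\<tau> k i) \<omega>)))" for \<omega>
    \<comment> \<open>The error of replacing \<open>A k i\<close> by the selected value, seen
      through \<psi>; summed over the increments it gives the difference \<open>D\<close> of
      \<open>P\<close> and \<open>\<psi> (S \<omega>)\<close>.\<close>
    define \<phi> where "\<phi> i = \<psi> o\<^sub>L (\<Phi> (\<sigma> i) - A k i)" for i
    define D where "D \<omega> = (\<Sum>i<n k. \<phi> i (L (\<tau> k (Suc i)) \<omega> - L (\<tau> k i) \<omega>))" for \<omega>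
    have \<tau>: "0 \<le> \<tau> k i" "\<tau> k i \<le> \<tau> k (Suc i)" if "i < n k" for i
      using partition_of_bounds[OF part[of k]] part[of k] that by (auto simp: partition_of_def)
    have \<tau>0: "0 \<le> \<tau> k i" if "i \<le> n k" for i
      using partition_of_bounds[OF part[of k]] that by auto
    have D: "D \<omega> = P \<omega> - \<psi> (S \<omega>)" for \<omega>
      by (simp add: D_def P_def S_def step_integral_def \<phi>_def blinfun.diff_left blinfun.diff_right
          blinfun.sum_right sum_subtractf)
    have Dsq: "integrable M (\<lambda>\<omega>. (D \<omega>)\<^sup>2)"
      and "expectation (\<lambda>\<omega>. (D \<omega>)\<^sup>2) \<le> K * (\<Sum>i<n k. (norm (\<phi> i))\<^sup>2 * (\<tau> k (Suc i) - \<tau> k i))"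
      using second_moment_functional_sum[OF sq c part] unfolding D_def K_def by auto
    note this(2)
    also have "\<dots> \<le> K * (\<Sum>i<n k. (norm \<psi>)\<^sup>2 * ((norm (\<Phi> (\<sigma> i) - A k i))\<^sup>2 * (\<tau> k (Suc i) - \<tau> k i)))"
    proof (intro mult_left_mono[OF _ K] sum_mono)
      fix i assume i: "i \<in> {..<n k}"
      have "(norm (\<phi> i))\<^sup>2 \<le> (norm \<psi> * norm (\<Phi> (\<sigma> i) - A k i))\<^sup>2"
        unfolding \<phi>_def by (intro power_mono norm_blinfun_compose) auto
      thus "(norm (\<phi> i))\<^sup>2 * (\<tau> k (Suc i) - \<tau> k i)
          \<le> (norm \<psi>)\<^sup>2 * ((norm (\<Phi> (\<sigma> i) - A k i))\<^sup>2 * (\<tau> k (Suc i) - \<tau> k i))"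
        using mult_right_mono[of _ _ "\<tau> k (Suc i) - \<tau> k i"] \<tau>(2)[of i] i
        by (simp add: power_mult_distrib mult.assoc[symmetric])
    qed
    also have "\<dots> = K * (norm \<psi>)\<^sup>2 * (\<Sum>i<n k. (norm (\<Phi> (\<sigma> i) - A k i))\<^sup>2 * (\<tau> k (Suc i) - \<tau> k i))"
      by (simp add: sum_distrib_left mult_ac)
    finally have "ennreal (expectation (\<lambda>\<omega>. (D \<omega>)\<^sup>2))
        \<le> ennreal (K * (norm \<psi>)\<^sup>2 * (\<Sum>i<n k. (norm (\<Phi> (\<sigma> i) - A k i))\<^sup>2 * (\<tau> k (Suc i) - \<tau> k i)))"
      by (rule ennreal_leI)
    also have "\<dots> = ennreal (K * (norm \<psi>)\<^sup>2) * ennreal (\<Sum>i<n k. (norm (\<Phi> (\<sigma> i) - A k i))\<^sup>2 * (\<tau> k (Suc i) - \<tau> k i))"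
      using K \<tau>(2) by (intro ennreal_mult sum_nonneg mult_nonneg_nonneg) simp_all
    also have "\<dots> \<le> ennreal (K * (norm \<psi>)\<^sup>2) * (J k + ennreal (1 / real (Suc k) * t))"
      by (rule mult_left_mono[OF \<sigma>_le]) simp
    finally have ED: "ennreal (expectation (\<lambda>\<omega>. (D \<omega>)\<^sup>2))
        \<le> ennreal (K * (norm \<psi>)\<^sup>2) * (J k + ennreal (1 / real (Suc k) * t))" .
    have [measurable]: "S \<in> borel_measurable M"
      unfolding S_def step_integral_def[abs_def]
      by (intro borel_measurable_sum levy_measurable \<tau>0) (auto intro!: continuous_intros)
    have [measurable]: "(\<lambda>\<omega>. (D \<omega>)\<^sup>2) \<in> borel_measurable M" using Dsq by auto
    have "AE \<omega> in M. \<forall>i<n k. 0 \<le> \<psi> (\<Phi> (\<sigma> i) (L (\<tau> k (Suc i)) \<omega> - L (\<tau> k i) \<omega>))"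
      unfolding AE_all_countable using pos[OF \<sigma> \<tau>] by auto
    hence "AE \<omega> in M. ennreal (N \<omega>) \<le> ennreal (2 * (D \<omega>)\<^sup>2 + 2 * (norm \<psi>)\<^sup>2 * (norm (S \<omega> - Z \<omega>))\<^sup>2)"
    proof eventually_elim
      case (elim \<omega>)
      hence P: "0 \<le> P \<omega>" unfolding P_def by (intro sum_nonneg) auto
      \<comment> \<open>The right-hand side is the modulus of
        \<open>P \<omega> - \<psi> (Z \<omega>)\<close>, which dominates the negative part because
        \<open>P \<omega>\<close> is non-negative.\<close>
      have "\<bar>max 0 (- \<psi> (Z \<omega>))\<bar> \<le> \<bar>D \<omega> + \<psi> (S \<omega> - Z \<omega>)\<bar>"
        using P by (simp add: D blinfun.diff_right)
      hence "N \<omega> \<le> (D \<omega> + \<psi> (S \<omega> - Z \<omega>))\<^sup>2"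
        unfolding N_def by (simp only: abs_le_square_iff)
      also have "\<dots> \<le> 2 * (D \<omega>)\<^sup>2 + 2 * (\<psi> (S \<omega> - Z \<omega>))\<^sup>2"
        using sum_squares_bound[of "D \<omega>" "\<psi> (S \<omega> - Z \<omega>)"] by (simp add: power2_sum)
      also have "(\<psi> (S \<omega> - Z \<omega>))\<^sup>2 \<le> (norm \<psi>)\<^sup>2 * (norm (S \<omega> - Z \<omega>))\<^sup>2"
        using power_mono[OF norm_blinfun[of \<psi> "S \<omega> - Z \<omega>"], of 2] by (simp add: power_mult_distrib)
      finally show ?case by (intro ennreal_leI) simp
    qed
    hence "(\<integral>\<^sup>+\<omega>. ennreal (N \<omega>) \<partial>M)
        \<le> (\<integral>\<^sup>+\<omega>. ennreal (2 * (D \<omega>)\<^sup>2 + 2 * (norm \<psi>)\<^sup>2 * (norm (S \<omega> - Z \<omega>))\<^sup>2) \<partial>M)"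
      by (rule nn_integral_mono_AE)
    also have "\<dots> = (\<integral>\<^sup>+\<omega>. ennreal 2 * ennreal ((D \<omega>)\<^sup>2)
        + ennreal (2 * (norm \<psi>)\<^sup>2) * ennreal ((norm (S \<omega> - Z \<omega>))\<^sup>2) \<partial>M)"
      by (intro nn_integral_cong) (simp add: ennreal_plus ennreal_mult)
    also have "\<dots> = ennreal 2 * (\<integral>\<^sup>+\<omega>. ennreal ((D \<omega>)\<^sup>2) \<partial>M) + ennreal (2 * (norm \<psi>)\<^sup>2) * E k"
      unfolding E_def S_def[symmetric] by (simp add: nn_integral_add nn_integral_cmult)
    also have "(\<integral>\<^sup>+\<omega>. ennreal ((D \<omega>)\<^sup>2) \<partial>M) = ennreal (expectation (\<lambda>\<omega>. (D \<omega>)\<^sup>2))"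
      by (rule nn_integral_eq_integral[OF Dsq]) simp
    also note ED
    finally show ?thesis
      using K by (simp add: ennreal_mult mult.assoc add_right_mono mult_left_mono)
  qed
  \<comment> \<open>\<open>J k\<close> and \<open>E k\<close> tend to 0 by the choice of the
    approximating sequence, so the bound on the fixed integral of \<open>N\<close> does too.\<close>
  have "(\<lambda>k. ennreal (2 * (K * (norm \<psi>)\<^sup>2)) * (J k + ennreal (1 / real (Suc k) * t)) + ennreal (2 * (norm \<psi>)\<^sup>2) * E k)
      \<longlonglongrightarrow> ennreal (2 * (K * (norm \<psi>)\<^sup>2)) * (0 + ennreal (0 * t)) + ennreal (2 * (norm \<psi>)\<^sup>2) * 0"
    unfolding J_def E_def
    by (intro tendsto_add ennreal_tendsto_cmult lim\<Phi> limZ tendsto_ennrealI tendsto_mult tendsto_const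
        LIMSEQ_Suc[OF lim_1_over_n]) auto
  hence "(\<integral>\<^sup>+\<omega>. ennreal (N \<omega>) \<partial>M) \<le> 0"
    using LIMSEQ_le_const[of _ _ "\<integral>\<^sup>+\<omega>. ennreal (N \<omega>) \<partial>M"] bound by fastforce
  moreover have "(\<lambda>\<omega>. ennreal (N \<omega>)) \<in> borel_measurable M"
  proof -
    have [measurable]: "blinfun_apply \<psi> \<in> borel_measurable borel"
      by (intro borel_measurable_continuous_onI continuous_intros)
    show ?thesis unfolding N_def by measurable
  qed
  ultimately have "AE \<omega> in M. ennreal (N \<omega>) = 0"
    by (subst (asm) le_zero_eq, subst (asm) nn_integral_0_iff_AE) auto
  thus ?thesis
  proof eventually_elim
    case (elim \<omega>)
    thus ?case by (auto simp: N_def ennreal_eq_0_iff power2_less_eq_zero_iff max_def split: if_splits)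
  qed
qed

section \<open>The cone of non-negative definite operators\<close>

lemma blinfun_exp_summable:
  fixes A :: "'a::banach \<Rightarrow>\<^sub>L 'a"
  shows "summable (\<lambda>n. (((o\<^sub>L) A ^^ n) id_blinfun) /\<^sub>R fact n)"
proof (rule summable_comparison_test[OF _ summable_exp[of "norm A"]], intro exI allI impI)
  fix n
  have "norm (((o\<^sub>L) A ^^ n) id_blinfun) \<le> norm A ^ n"
  proof (induction n)
    case (Suc n)
    thus ?case
      using order_trans[OF norm_blinfun_compose mult_left_mono[OF Suc norm_ge_zero[of A]]] by simp
  \<comment> \<open>The base case is only an inequality, since the identity has norm 0 on the
    trivial space.\<close>
  qed (simp add: norm_blinfun_id_le)
  thus "norm ((((o\<^sub>L) A ^^ n) id_blinfun) /\<^sub>R fact n) \<le> inverse (fact n) * norm A ^ n"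
    by (simp add: mult_left_mono)
qed

text \<open>The partial sums of the series at \<open>x\<close> are combinations of iterates in
  \<open>S\<close> with the non-negative coefficients \<open>1 / k!\<close>, hence stay in
  \<open>S\<close>; closedness passes this to the limit.\<close>

lemma blinfun_exp_invariant:
  fixes A :: "'a::banach \<Rightarrow>\<^sub>L 'a"
  assumes cl: "closed S" and zero: "0 \<in> S" and add: "\<And>x y. x \<in> S \<Longrightarrow> y \<in> S \<Longrightarrow> x + y \<in> S"
    and scale: "\<And>r x. 0 \<le> r \<Longrightarrow> x \<in> S \<Longrightarrow> r *\<^sub>R x \<in> S"
    and A: "blinfun_apply A ` S \<subseteq> S" and "x \<in> S"
  shows "blinfun_exp A x \<in> S"
proof -
  have pow: "(((o\<^sub>L) A ^^ n) id_blinfun) x \<in> S" for n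
    using A \<open>x \<in> S\<close> by (induction n) auto
  have "(\<lambda>n. \<Sum>k<n. (((o\<^sub>L) A ^^ k) id_blinfun) /\<^sub>R fact k) \<longlonglongrightarrow> blinfun_exp A"
    unfolding blinfun_exp_def by (rule summable_LIMSEQ[OF blinfun_exp_summable])
  hence lim: "(\<lambda>n. blinfun_apply (\<Sum>k<n. (((o\<^sub>L) A ^^ k) id_blinfun) /\<^sub>R fact k) x) \<longlonglongrightarrow> blinfun_exp A x"
    by (intro tendsto_intros)
  have "blinfun_apply (\<Sum>k<n. (((o\<^sub>L) A ^^ k) id_blinfun) /\<^sub>R fact k) x \<in> S" for n
  proof -
    have "(\<Sum>k<n. inverse (fact k) *\<^sub>R (((o\<^sub>L) A ^^ k) id_blinfun) x) \<in> S"
      by (induction n) (auto intro!: add scale pow zero)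
    thus ?thesis by (simp add: blinfun.sum_left blinfun.scaleR_left)
  qed
  from closed_sequentially[OF cl this lim] show ?thesis .
qed

text \<open>Packaged as a bounded functional so that the moment and positivity results for
  functionals apply to it.\<close>

definition hs_quadratic_form :: "'h::{real_inner, banach, second_countable_topology} \<Rightarrow> 'h hs_op \<Rightarrow>\<^sub>L real" where
  "hs_quadratic_form f = Blinfun (\<lambda>T. hs_apply T f \<bullet> f)"

lemma bounded_linear_hs_apply_inner: "bounded_linear (\<lambda>T. hs_apply T f \<bullet> g)"
  by (intro bounded_linear_inner_left_comp bounded_bilinear.bounded_linear_left bounded_bilinear_hs_apply)

lemma hs_quadratic_form [simp]: "hs_quadratic_form f T = hs_apply T f \<bullet> f"
  by (simp add: hs_quadratic_form_def bounded_linear_Blinfun_apply bounded_linear_hs_apply_inner)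

lemma closed_hs_cone: "closed hs_cone"
proof -
  have "hs_cone = (\<Inter>f. {T. 0 \<le> hs_quadratic_form f T})"
    by (auto simp: hs_cone_def hs_nonneg_def)
  also have "closed \<dots>" by (intro closed_INT ballI closed_Collect_le continuous_intros)
  finally show ?thesis .
qed

lemma hs_cone_zero: "0 \<in> hs_cone"
  by (simp add: hs_cone_def hs_nonneg_def zero_hs_op.rep_eq)

lemma hs_cone_add: "S \<in> hs_cone \<Longrightarrow> T \<in> hs_cone \<Longrightarrow> S + T \<in> hs_cone"
  by (simp add: hs_cone_def hs_nonneg_def plus_hs_op.rep_eq inner_add_left)

lemma hs_cone_scaleR: "0 \<le> r \<Longrightarrow> T \<in> hs_cone \<Longrightarrow> r *\<^sub>R T \<in> hs_cone"
  by (simp add: hs_cone_def hs_nonneg_def scaleR_hs_op.rep_eq)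

lemma blinfun_exp_hs_cone:
  assumes "blinfun_apply C ` hs_cone \<subseteq> hs_cone" "0 \<le> r" "T \<in> hs_cone"
  shows "blinfun_exp (r *\<^sub>R C) T \<in> hs_cone"
proof (rule blinfun_exp_invariant[OF closed_hs_cone hs_cone_zero hs_cone_add hs_cone_scaleR _ assms(3)])
  show "blinfun_apply (r *\<^sub>R C) ` hs_cone \<subseteq> hs_cone"
    using assms by (auto simp: blinfun.scaleR_left intro!: hs_cone_scaleR)
qed

section \<open>Quadratic forms and the mean of the process\<close>

text \<open>Polarization: expanding the form at \<open>x + y\<close> leaves twice the mixed term,
  since self-adjointness makes the two mixed terms equal.\<close>

lemma hs_self_adjoint_eqI:
  assumes "hs_self_adjoint S" "hs_self_adjoint T" and eq: "\<And>f. hs_apply S f \<bullet> f = hs_apply T f \<bullet> f"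
  shows "S = T"
proof (rule hs_op_eqI)
  fix x
  interpret S: bounded_linear "hs_apply S" by (rule bounded_linear_hs_apply)
  interpret T: bounded_linear "hs_apply T" by (rule bounded_linear_hs_apply)
  have "hs_apply S x \<bullet> y = hs_apply T x \<bullet> y" for y
  proof -
    have sa: "hs_apply S y \<bullet> x = hs_apply S x \<bullet> y" "hs_apply T y \<bullet> x = hs_apply T x \<bullet> y"
      using assms(1,2) unfolding hs_self_adjoint_def by (metis inner_commute)+
    show ?thesis
      using eq[of "x + y"] eq[of x] eq[of y] sa
      by (simp add: S.add T.add inner_add_left inner_add_right)
  qed
  thus "hs_apply S x = hs_apply T x" using vector_eq_rdot by blast
qed

text \<open>Monotonicity of the paths makes \<open>t \<mapsto> E (L(t) f, f)\<close> additive and non-negative, hence linear;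
  self-adjointness recovers the operator \<open>E L(t)\<close> from these quadratic forms.\<close>

lemma expectation_non_decreasing_levy:
  fixes L :: "real \<Rightarrow> 'w \<Rightarrow> 'h::{real_inner, banach, second_countable_topology} hs_op"
  assumes levy: "levy_process M L" and sq: "square_integrable_process M L"
    and mono: "non_decreasing_paths M L" and t: "0 \<le> t"
  shows "integral\<^sup>L M (L t) = t *\<^sub>R integral\<^sup>L M (L 1)" and "integrable M (L t)"
proof -
  interpret levy_process M L by (rule levy)
  have int: "integrable M (L s)" if "0 \<le> s" for s
  proof -
    have m[measurable]: "L s \<in> borel_measurable M" by (rule random_variable_levy[OF that])
    have "integrable M (\<lambda>\<omega>. norm (L s \<omega>))"
      by (rule square_integrable_imp_integrable) (use sq that in \<open>auto simp: square_integrable_process_def\<close>)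
    thus ?thesis by (simp add: integrable_norm_iff)
  qed
  thus "integrable M (L t)" using t .
  have inner: "hs_apply (expectation (L s)) f \<bullet> g = expectation (\<lambda>\<omega>. hs_apply (L s \<omega>) f \<bullet> g)"
    if "0 \<le> s" for s f g
    by (rule integral_bounded_linear[OF bounded_linear_hs_apply_inner int[OF that], symmetric])
  have sa: "hs_self_adjoint (expectation (L s))" if "0 \<le> s" for s
    unfolding hs_self_adjoint_def
  proof (intro allI)
    fix f g
    have "expectation (\<lambda>\<omega>. hs_apply (L s \<omega>) f \<bullet> g) = expectation (\<lambda>\<omega>. hs_apply (L s \<omega>) g \<bullet> f)"
    proof (rule integral_cong_AE)
      show "AE \<omega> in M. hs_apply (L s \<omega>) f \<bullet> g = hs_apply (L s \<omega>) g \<bullet> f"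
        using mono unfolding non_decreasing_paths_def
      proof eventually_elim
        case (elim \<omega>)
        hence "hs_apply (L s \<omega>) f \<bullet> g = f \<bullet> hs_apply (L s \<omega>) g"
          using that by (simp add: hs_self_adjoint_def)
        thus ?case by (simp only: inner_commute)
      qed
    qed (intro borel_measurable_integrable integrable_bounded_linear[OF bounded_linear_hs_apply_inner int[OF that]])+
    thus "hs_apply (expectation (L s)) f \<bullet> g = f \<bullet> hs_apply (expectation (L s)) g"
      by (simp add: inner[OF that] inner_commute[of f])
  qed
  have "expectation (\<lambda>\<omega>. hs_quadratic_form f (L t \<omega>)) = t * expectation (\<lambda>\<omega>. hs_quadratic_form f (L 1 \<omega>))" for f
  proof (rule additive_nonneg_imp_linear[OF expectation_functional_add[OF sq] _ t])
    fix s :: real assume "0 \<le> s"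
    show "0 \<le> expectation (\<lambda>\<omega>. hs_quadratic_form f (L s \<omega>))"
    proof (rule integral_nonneg_AE)
      show "AE \<omega> in M. 0 \<le> hs_quadratic_form f (L s \<omega>)"
        using start_zero mono unfolding non_decreasing_paths_def
      proof eventually_elim
        case (elim \<omega>)
        \<comment> \<open>Monotonicity from time 0, where the process vanishes almost surely, gives
          the sign.\<close>
        hence "hs_apply (L 0 \<omega>) f \<bullet> f \<le> hs_apply (L s \<omega>) f \<bullet> f"
          using \<open>0 \<le> s\<close> by (auto dest!: spec[of _ f] dest: mono_onD[of _ _ 0 s])
        thus ?case using elim by (simp add: zero_hs_op.rep_eq)
      qed
    qed
  qed
  hence quad: "hs_apply (expectation (L t)) f \<bullet> f = hs_apply (t *\<^sub>R expectation (L 1)) f \<bullet> f" for f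
    using inner[OF t] inner[of 1] by (simp add: scaleR_hs_op.rep_eq)
  show "expectation (L t) = t *\<^sub>R expectation (L 1)"
    by (rule hs_self_adjoint_eqI[OF sa[OF t] _ quad])
      (use sa[of 1] in \<open>auto simp: hs_self_adjoint_def scaleR_hs_op.rep_eq\<close>)
qed

section \<open>From quadratic forms to the mild solution\<close>

text \<open>The vectors violating positivity form an open set; if non-empty, it would meet
  \<open>D\<close>.\<close>

lemma hs_nonneg_if_dense:
  assumes D: "\<And>X. open X \<Longrightarrow> X \<noteq> {} \<Longrightarrow> \<exists>y\<in>D. y \<in> X" and nn: "\<And>f. f \<in> D \<Longrightarrow> 0 \<le> hs_apply T f \<bullet> f"
  shows "hs_nonneg T"
proof -
  have "closed {f. 0 \<le> hs_apply T f \<bullet> f}"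
    by (intro closed_Collect_le continuous_intros linear_continuous_on bounded_linear_hs_apply)
  hence "open (- {f. 0 \<le> hs_apply T f \<bullet> f})" by (rule open_Compl)
  thus ?thesis using D nn unfolding hs_nonneg_def by blast
qed

theorem proposition2p11:
  fixes M :: "'w measure"
    and L :: "real \<Rightarrow> 'w \<Rightarrow> 'h::{real_inner, banach, second_countable_topology} hs_op"
    and C :: "'h hs_op \<Rightarrow>\<^sub>L 'h hs_op"
    and Y0 :: "'h hs_op"
    and Y :: "real \<Rightarrow> 'w \<Rightarrow> 'h hs_op"
  assumes "blinfun_apply C ` hs_cone \<subseteq> hs_cone"
    and "levy_process M L"
    and "square_integrable_process M L"
    and "non_decreasing_paths M L"
    and "hs_nonneg Y0"
    and "mild_solution M C L Y0 Y"
  shows "\<forall>t\<ge>0. AE \<omega> in M. hs_nonneg (Y t \<omega>)"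
proof (intro allI impI)
  fix t :: real assume t: "0 \<le> t"
  interpret levy_process M L by (rule assms(2))
  obtain Z where Z: "has_stochastic_integral M L t (\<lambda>s. blinfun_exp ((t - s) *\<^sub>R C)) Z"
    and Y: "AE \<omega> in M. Y t \<omega> = blinfun_exp (t *\<^sub>R C) Y0 + Z \<omega>"
    using assms(6) t unfolding mild_solution_def by blast
  note mean = expectation_non_decreasing_levy[OF assms(2-4)]
  \<comment> \<open>Functionals commute with the expectation, and the mean is linear in time; this
    gives the constant \<open>norm (expectation (L 1))\<close>.\<close>
  have mean_le: "\<bar>expectation (\<lambda>\<omega>. blinfun_apply \<phi> (L s \<omega>))\<bar> \<le> norm (expectation (L 1)) * norm \<phi> * s"
    if "0 \<le> s" for \<phi> s
  proof -
    have "expectation (\<lambda>\<omega>. \<phi> (L s \<omega>)) = \<phi> (expectation (L s))"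
      by (rule integral_bounded_linear[OF blinfun.bounded_linear_right mean(2)[OF that]])
    also have "\<dots> = s * \<phi> (expectation (L 1))" by (simp add: mean(1)[OF that] blinfun.scaleR_right)
    finally show ?thesis
      using mult_left_mono[OF norm_blinfun[of \<phi> "expectation (L 1)"] that] that
      by (simp add: abs_mult mult_ac)
  qed
  have quad: "AE \<omega> in M. 0 \<le> hs_quadratic_form f (Z \<omega>)" for f
  proof (rule has_stochastic_integral_functional_nonneg[OF assms(3) _ mean_le t Z])
    fix s u v :: real assume s: "s \<in> {0..t}" and uv: "0 \<le> u" "u \<le> v"
    show "AE \<omega> in M. 0 \<le> hs_quadratic_form f (blinfun_exp ((t - s) *\<^sub>R C) (L v \<omega> - L u \<omega>))"
      using assms(4) unfolding non_decreasing_paths_def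
    proof eventually_elim
      case (elim \<omega>)
      \<comment> \<open>Non-decreasing paths put the increment in the cone, and the exponential
        keeps it there because \<open>t - s\<close> is non-negative.\<close>
      have "L v \<omega> - L u \<omega> \<in> hs_cone"
        using elim uv by (auto simp: hs_cone_def hs_nonneg_def minus_hs_op.rep_eq inner_diff_left mono_on_def)
      hence "blinfun_exp ((t - s) *\<^sub>R C) (L v \<omega> - L u \<omega>) \<in> hs_cone"
        using s by (intro blinfun_exp_hs_cone[OF assms(1)]) auto
      thus ?case by (simp add: hs_cone_def hs_nonneg_def)
    qed
  qed simp
  \<comment> \<open>The exceptional null set in \<open>quad\<close> depends on \<open>f\<close>;
    countably many of them can be merged into one.\<close>
  obtain D :: "'h set" where D: "countable D" "\<And>X. open X \<Longrightarrow> X \<noteq> {} \<Longrightarrow> \<exists>y\<in>D. y \<in> X"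
    using countable_dense_setE by blast
  have "AE \<omega> in M. \<forall>f\<in>D. 0 \<le> hs_quadratic_form f (Z \<omega>)"
    using quad by (simp add: AE_ball_countable D(1))
  thus "AE \<omega> in M. hs_nonneg (Y t \<omega>)"
    using Y
  proof eventually_elim
    case (elim \<omega>)
    have "Z \<omega> \<in> hs_cone" using hs_nonneg_if_dense[OF D(2)] elim by (auto simp: hs_cone_def)
    moreover have "blinfun_exp (t *\<^sub>R C) Y0 \<in> hs_cone"
      using assms(5) by (intro blinfun_exp_hs_cone[OF assms(1) t]) (simp add: hs_cone_def)
    ultimately have "Y t \<omega> \<in> hs_cone" using elim by (simp add: hs_cone_add)
    thus ?case by (simp add: hs_cone_def)
  qed
qed

end
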